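(* Let $Q$ be a finite quiver, let $V$ and $W$ be representations of $Q$ over $\mathbb{F}_1$, and let $K$ be a field. Then the set $$\mathscr{B}_{V,W}=\{\mathbf{b}^C\mid C\text{ an admissible component of }\Gamma_{V\otimes W}\},\qquad \mathbf{b}^C=\sum_{(v,w)\in C_0}\mathbf{b}_{v,w},$$ is a basis of the $K$-vector space $\mathrm{Hom}_{KQ}(V^K,W^K)$.
   Context: A quiver $Q=(Q_0,Q_1,s,t)$ has vertex set $Q_0$, arrow set $Q_1$ (both finite), and source/target maps $s,t\colon Q_1\to Q_0$. An $\mathbb{F}_1$-vector space is a finite pointed set $(V,0_V)$. An $\mathbb{F}_1$-linear map $f\colon V\to W$ is a pointed map that is injective on $V\setminus f^{-1}(0_W)$. A representation $V$ of $Q$ over $\mathbb{F}_1$ consists of an $\mathbb{F}_1$-vector space $V_i$ for each $i\in Q_0$ and an $\mathbb{F}_1$-linear map $V_\alpha\colon V_{s(\alpha)}\to V_{t(\alpha)}$ for each $\alpha\in Q_1$. Scalar extension: $V^K$ is the representation of $Q$ over $K$ where $V^K_i$ is the free $K$-vector space on $V_i\setminus\{0_{V_i}\}$ and the arrows act by the $K$-linear extensions of the maps $V_\alpha$ (with $0_{V_i}$ identified with $0$). $\mathrm{Hom}_{KQ}(V^K,W^K)$ is the space of homomorphisms of quiver representations over $K$, a subspace of $\prod_{i\in Q_0}\mathrm{Hom}_K(V^K_i,W^K_i)$. For $i\in Q_0$, $v\in V_i\setminus\{0_{V_i}\}$, $w\in W_i\setminus\{0_{W_i}\}$, the $K$-linear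 map $\mathbf{b}_{v,w}\colon V^K_i\to W^K_i$ is given by $\mathbf{b}_{v,w}(v')=\delta_{v,v'}w$ for all $v'\in V_i\setminus\{0_{V_i}\}$; it is regarded as an element of $\prod_{i\in Q_0}\mathrm{Hom}_K(V^K_i,W^K_i)$. Coefficient quiver: $\Gamma_V$ has vertex set $\coprod_{i\in Q_0}V_i\setminus\{0_{V_i}\}$ and arrow set $\coprod_{\alpha\in Q_1}\{(v,w)\in((\Gamma_V)_0)^2\mid V_\alpha(v)=w\}$, with $s((v,w))=v$, $t((v,w))=w$. The quiver morphism $c_V\colon\Gamma_V\to Q$ is induced by these disjoint unions. Tensor product: $(V\otimes W)_i=V_i\times W_i/(V_i\times\{0_{W_i}\}\cup\{0_{V_i}\}\times W_i)$ with $(V\otimes W)_\alpha(v\otimes w)=V_\alpha(v)\otimes W_\alpha(w)$. Its coefficient quiver $\Gamma_{V\otimes W}$ is identified with the quiver whose vertices are pairs $(v,w)\in(\Gamma_V)_0\times(\Gamma_W)_0$ with $c_V(v)=c_W(w)$ and whose arrows are pairs $(a,b)\in(\Gamma_V)_1\times(\Gamma_W)_1$ with $c_V(a)=c_W(b)$, where $s((a,b))=(s(a),s(b))$, $t((a,b))=(t(a),t(b))$. Let $C\subset\Gamma_{V\otimes W}$ be a connected component (connectedness in the underlying undirected graph). $C$ reflects successors if for all $(v,w)\in C_0$ and all $b\in(\Gamma_W)_1$ with $s(b)=w$ there is $a\in(\Gamma_V)_1$ with $s(a)=v$ and $c_V(a)=c_W(b)$. $C$ induces predecessors if for all $(v',w')\in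 C_0$ and all $a\in(\Gamma_V)_1$ with $t(a)=v'$ there is $b\in(\Gamma_W)_1$ with $t(b)=w'$ and $c_V(a)=c_W(b)$. $C$ is an admissible component if it reflects successors and induces predecessors. *)

theory Defs
  imports
    "HOL-Library.Function_Algebras"
    "Graph_Theory.Digraph_Component"
    "Graph_Theory.Digraph_Isomorphism"
begin

section \<open>Representations over the field with one element\<close>

text \<open>
  A finite quiver is a \<^locale>\<open>fin_digraph\<close> (loops and multiple arrows are allowed); source and
  target are \<^const>\<open>tail\<close> and \<^const>\<open>head\<close>.
  The pointed sets \<open>V\<^sub>i\<close> all live in one type \<open>'v\<close>, but each has its own carrier and base point, and
  they may overlap.
\<close>

record ('q, 'a, 'v) f1_rep =
  pts :: "'q \<Rightarrow> 'v set"
  base :: "'q \<Rightarrow> 'v"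
  act :: "'a \<Rightarrow> 'v \<Rightarrow> 'v"

definition f1_vector_space :: "'v set \<Rightarrow> 'v \<Rightarrow> bool" where
  "f1_vector_space S z \<longleftrightarrow> finite S \<and> z \<in> S"

definition f1_linear :: "'v set \<Rightarrow> 'v \<Rightarrow> 'w set \<Rightarrow> 'w \<Rightarrow> ('v \<Rightarrow> 'w) \<Rightarrow> bool" where
  "f1_linear S z T z' f \<longleftrightarrow> f ` S \<subseteq> T \<and> f z = z' \<and> inj_on f (S - f -` {z'})"

definition f1_representation :: "('q, 'a) pre_digraph \<Rightarrow> ('q, 'a, 'v) f1_rep \<Rightarrow> bool" where
  "f1_representation Q V \<longleftrightarrow>
     (\<forall>i \<in> verts Q. f1_vector_space (pts V i) (base V i)) \<and>
     (\<forall>\<alpha> \<in> arcs Q. f1_linear (pts V (tail Q \<alpha>)) (base V (tail Q \<alpha>))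
                             (pts V (head Q \<alpha>)) (base V (head Q \<alpha>)) (act V \<alpha>))"

abbreviation nonzero :: "('q, 'a, 'v) f1_rep \<Rightarrow> 'q \<Rightarrow> 'v set" where
  "nonzero V i \<equiv> pts V i - {base V i}"


section \<open>Coefficient quivers\<close>

text \<open>
  The disjoint unions are tagged: a vertex is \<open>(i, v)\<close> and an arrow is \<open>(\<alpha>, x, y)\<close>. The quiver
  morphism \<open>c\<^sub>V\<close> is \<^const>\<open>fst\<close>, on vertices as well as on arrows.
\<close>

definition coeff_quiver ::
  "('q, 'a) pre_digraph \<Rightarrow> ('q, 'a, 'v) f1_rep \<Rightarrow> ('q \<times> 'v, 'a \<times> ('q \<times> 'v) \<times> ('q \<times> 'v)) pre_digraph"
where
  "coeff_quiver Q V = \<lparr>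
     verts = Sigma (verts Q) (nonzero V),
     arcs = {(\<alpha>, (i, v), (j, w)) | \<alpha> i v j w. \<alpha> \<in> arcs Q \<and>
               (i, v) \<in> Sigma (verts Q) (nonzero V) \<and> (j, w) \<in> Sigma (verts Q) (nonzero V) \<and>
               i = tail Q \<alpha> \<and> j = head Q \<alpha> \<and> act V \<alpha> v = w},
     tail = (\<lambda>(\<alpha>, x, y). x),
     head = (\<lambda>(\<alpha>, x, y). y)\<rparr>"

text \<open>
  The quiver of compatible pairs with which the coefficient quiver of \<open>V \<otimes> W\<close> is identified; the
  identification is proved in \<open>coeff_quiver_tensor\<close> below.
\<close>

definition tensor_coeff_quiver ::
  "('q, 'a) pre_digraph \<Rightarrow> ('q, 'a, 'v) f1_rep \<Rightarrow> ('q, 'a, 'w) f1_rep \<Rightarrow>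
    (('q \<times> 'v) \<times> ('q \<times> 'w),
     ('a \<times> ('q \<times> 'v) \<times> ('q \<times> 'v)) \<times> ('a \<times> ('q \<times> 'w) \<times> ('q \<times> 'w))) pre_digraph"
where
  "tensor_coeff_quiver Q V W = \<lparr>
     verts = {(x, y). x \<in> verts (coeff_quiver Q V) \<and> y \<in> verts (coeff_quiver Q W) \<and> fst x = fst y},
     arcs = {(a, b). a \<in> arcs (coeff_quiver Q V) \<and> b \<in> arcs (coeff_quiver Q W) \<and> fst a = fst b},
     tail = (\<lambda>(a, b). (tail (coeff_quiver Q V) a, tail (coeff_quiver Q W) b)),
     head = (\<lambda>(a, b). (head (coeff_quiver Q V) a, head (coeff_quiver Q W) b))\<rparr>"


section \<open>Tensor products\<close>

text \<open>
  An element of \<open>(V \<otimes> W)\<^sub>i\<close> is an equivalence class: the collapsed set, or a singleton.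
\<close>

definition collapsed :: "('q, 'a, 'v) f1_rep \<Rightarrow> ('q, 'a, 'w) f1_rep \<Rightarrow> 'q \<Rightarrow> ('v \<times> 'w) set" where
  "collapsed V W i = pts V i \<times> {base W i} \<union> {base V i} \<times> pts W i"

definition collapse_rel ::
  "('q, 'a, 'v) f1_rep \<Rightarrow> ('q, 'a, 'w) f1_rep \<Rightarrow> 'q \<Rightarrow> (('v \<times> 'w) \<times> ('v \<times> 'w)) set" where
  "collapse_rel V W i =
     Id_on (pts V i \<times> pts W i) \<union> collapsed V W i \<times> collapsed V W i"

definition tensor_elem ::
  "('q, 'a, 'v) f1_rep \<Rightarrow> ('q, 'a, 'w) f1_rep \<Rightarrow> 'q \<Rightarrow> 'v \<Rightarrow> 'w \<Rightarrow> ('v \<times> 'w) set" where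
  "tensor_elem V W i v w = collapse_rel V W i `` {(v, w)}"

definition tensor_rep ::
  "('q, 'a) pre_digraph \<Rightarrow> ('q, 'a, 'v) f1_rep \<Rightarrow> ('q, 'a, 'w) f1_rep \<Rightarrow>
    ('q, 'a, ('v \<times> 'w) set) f1_rep" where
  "tensor_rep Q V W = \<lparr>
     pts = (\<lambda>i. (pts V i \<times> pts W i) // collapse_rel V W i),
     base = (\<lambda>i. tensor_elem V W i (base V i) (base W i)),
     act = (\<lambda>\<alpha> X. the_elem
              ((\<lambda>(v, w). tensor_elem V W (head Q \<alpha>) (act V \<alpha> v) (act W \<alpha> w)) ` X))\<rparr>"


section \<open>Admissible components\<close>

text \<open>
  \<^const>\<open>connected\<close> is connectedness of the underlying undirected graph, and
  includes non-emptiness.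
\<close>

definition connected_component :: "('x, 'y) pre_digraph \<Rightarrow> ('x, 'y) pre_digraph \<Rightarrow> bool" where
  "connected_component G C \<longleftrightarrow> pre_digraph.max_subgraph G connected C"

definition reflects_successors ::
  "('q, 'a) pre_digraph \<Rightarrow> ('q, 'a, 'v) f1_rep \<Rightarrow> ('q, 'a, 'w) f1_rep \<Rightarrow>
    (('q \<times> 'v) \<times> ('q \<times> 'w), 'y) pre_digraph \<Rightarrow> bool" where
  "reflects_successors Q V W C \<longleftrightarrow>
     (\<forall>(v, w) \<in> verts C. \<forall>b \<in> arcs (coeff_quiver Q W). tail (coeff_quiver Q W) b = w \<longrightarrow>
        (\<exists>a \<in> arcs (coeff_quiver Q V). tail (coeff_quiver Q V) a = v \<and> fst a = fst b))"

definition induces_predecessors ::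
  "('q, 'a) pre_digraph \<Rightarrow> ('q, 'a, 'v) f1_rep \<Rightarrow> ('q, 'a, 'w) f1_rep \<Rightarrow>
    (('q \<times> 'v) \<times> ('q \<times> 'w), 'y) pre_digraph \<Rightarrow> bool" where
  "induces_predecessors Q V W C \<longleftrightarrow>
     (\<forall>(v', w') \<in> verts C. \<forall>a \<in> arcs (coeff_quiver Q V). head (coeff_quiver Q V) a = v' \<longrightarrow>
        (\<exists>b \<in> arcs (coeff_quiver Q W). head (coeff_quiver Q W) b = w' \<and> fst a = fst b))"

definition admissible_component where
  "admissible_component Q V W C \<longleftrightarrow>
     connected_component (tensor_coeff_quiver Q V W) C \<and>
     reflects_successors Q V W C \<and> induces_predecessors Q V W C"


section \<open>Representations over a field and their homomorphisms\<close>

text \<open>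
  Vectors are functions \<open>'v \<Rightarrow> 'k\<close> with pointwise operations; a \<open>K\<close>-representation has as its
  spaces subspaces of \<open>'v \<Rightarrow> 'k\<close>.
\<close>

record ('q, 'a, 'v, 'k) lin_rep =
  space :: "'q \<Rightarrow> ('v \<Rightarrow> 'k) set"
  lmap :: "'a \<Rightarrow> ('v \<Rightarrow> 'k) \<Rightarrow> ('v \<Rightarrow> 'k)"

definition vscale :: "'k::field \<Rightarrow> ('v \<Rightarrow> 'k) \<Rightarrow> ('v \<Rightarrow> 'k)" where
  "vscale c x = (\<lambda>v. c * x v)"

text \<open>
  Maps out of a subspace are made unique as functions by prescribing the value \<open>0\<close> outside of it,
  and likewise families at indices that are not vertices of the quiver.
\<close>

definition hom_K :: "('v \<Rightarrow> 'k::field) set \<Rightarrow> ('w \<Rightarrow> 'k) set \<Rightarrow> (('v \<Rightarrow> 'k) \<Rightarrow> ('w \<Rightarrow> 'k)) set" where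
  "hom_K S T = {g. (\<forall>x \<in> S. g x \<in> T) \<and>
                   (\<forall>x \<in> S. \<forall>y \<in> S. g (x + y) = g x + g y) \<and>
                   (\<forall>c. \<forall>x \<in> S. g (vscale c x) = vscale c (g x)) \<and>
                   (\<forall>x. x \<notin> S \<longrightarrow> g x = 0)}"

definition hom_prod ::
  "('q, 'a) pre_digraph \<Rightarrow> ('q, 'a, 'v, 'k::field) lin_rep \<Rightarrow> ('q, 'a, 'w, 'k) lin_rep \<Rightarrow>
    ('q \<Rightarrow> ('v \<Rightarrow> 'k) \<Rightarrow> ('w \<Rightarrow> 'k)) set" where
  "hom_prod Q M N = {f. (\<forall>i \<in> verts Q. f i \<in> hom_K (space M i) (space N i)) \<and>
                        (\<forall>i. i \<notin> verts Q \<longrightarrow> f i = 0)}"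

definition rep_hom ::
  "('q, 'a) pre_digraph \<Rightarrow> ('q, 'a, 'v, 'k::field) lin_rep \<Rightarrow> ('q, 'a, 'w, 'k) lin_rep \<Rightarrow>
    ('q \<Rightarrow> ('v \<Rightarrow> 'k) \<Rightarrow> ('w \<Rightarrow> 'k)) set" where
  "rep_hom Q M N = {f \<in> hom_prod Q M N. \<forall>\<alpha> \<in> arcs Q. \<forall>x \<in> space M (tail Q \<alpha>).
                      f (head Q \<alpha>) (lmap M \<alpha> x) = lmap N \<alpha> (f (tail Q \<alpha>) x)}"

definition fam_scale ::
  "'k::field \<Rightarrow> ('q \<Rightarrow> ('v \<Rightarrow> 'k) \<Rightarrow> ('w \<Rightarrow> 'k)) \<Rightarrow> ('q \<Rightarrow> ('v \<Rightarrow> 'k) \<Rightarrow> ('w \<Rightarrow> 'k))" where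
  "fam_scale c f = (\<lambda>i x. vscale c (f i x))"

definition is_basis_of ::
  "('k::field \<Rightarrow> 'x::ab_group_add \<Rightarrow> 'x) \<Rightarrow> 'x set \<Rightarrow> 'x set \<Rightarrow> bool" where
  "is_basis_of scale B U \<longleftrightarrow> B \<subseteq> U \<and> \<not> module.dependent scale B \<and> module.span scale B = U"


section \<open>Scalar extension\<close>

text \<open>
  The free space on \<open>S\<close> consists of the functions supported in \<open>S\<close>. It is only used for finite \<open>S\<close>,
  so finiteness of the support is automatic.
\<close>

definition free_space :: "'v set \<Rightarrow> ('v \<Rightarrow> 'k::field) set" where
  "free_space S = {x. \<forall>v. v \<notin> S \<longrightarrow> x v = 0}"

definition gen :: "'v \<Rightarrow> ('v \<Rightarrow> 'k::field)" where
  "gen v = (\<lambda>u. if u = v then 1 else 0)"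

definition scalar_ext ::
  "('q, 'a) pre_digraph \<Rightarrow> ('q, 'a, 'v) f1_rep \<Rightarrow> ('q, 'a, 'v, 'k::field) lin_rep" where
  "scalar_ext Q V = \<lparr>
     space = (\<lambda>i. free_space (nonzero V i)),
     lmap = (\<lambda>\<alpha> x. \<Sum>v \<in> nonzero V (tail Q \<alpha>). vscale (x v)
               (if act V \<alpha> v = base V (head Q \<alpha>) then 0 else gen (act V \<alpha> v)))\<rparr>"


section \<open>The maps attached to vertices and components\<close>

text \<open>
  The linear extension of \<open>v' \<mapsto> \<delta>\<^bsub>v,v'\<^esub> w\<close> sends \<open>x\<close> to its \<open>v\<close>-coordinate times \<open>w\<close>. As an element
  of the product it is \<open>0\<close> in all components but \<open>i\<close>; the tag of the second vertex is
  redundant, since \<open>v\<close> and \<open>w\<close> lie over the same vertex.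
\<close>

definition b_elem ::
  "('q, 'a, 'v) f1_rep \<Rightarrow> 'q \<times> 'v \<Rightarrow> 'q \<times> 'w \<Rightarrow> ('q \<Rightarrow> ('v \<Rightarrow> 'k::field) \<Rightarrow> ('w \<Rightarrow> 'k))" where
  "b_elem V = (\<lambda>(i, v) (_, w) l x.
     if l = i \<and> x \<in> free_space (nonzero V i) then vscale (x v) (gen w) else 0)"

definition b_comp ::
  "('q, 'a, 'v) f1_rep \<Rightarrow> (('q \<times> 'v) \<times> ('q \<times> 'w), 'y) pre_digraph \<Rightarrow>
    ('q \<Rightarrow> ('v \<Rightarrow> 'k::field) \<Rightarrow> ('w \<Rightarrow> 'k))" where
  "b_comp V C = (\<Sum>(v, w) \<in> verts C. b_elem V v w)"

definition basis_set ::
  "('q, 'a) pre_digraph \<Rightarrow> ('q, 'a, 'v) f1_rep \<Rightarrow> ('q, 'a, 'w) f1_rep \<Rightarrow>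
    ('q \<Rightarrow> ('v \<Rightarrow> 'k::field) \<Rightarrow> ('w \<Rightarrow> 'k)) set" where
  "basis_set Q V W = {b_comp V C | C. admissible_component Q V W C}"


section \<open>Consistency of the definitions\<close>

lemma vector_space_fam_scale: "vector_space fam_scale"
  by unfold_locales (auto simp: fam_scale_def vscale_def fun_eq_iff algebra_simps)

lemma vscale_zero [simp]: "vscale c 0 = 0"
  by (auto simp: vscale_def)

lemma vscale_sum: "vscale c (sum f A) = (\<Sum>a\<in>A. vscale c (f a))"
  by (induction A rule: infinite_finite_induct)
     (auto simp: vscale_def fun_eq_iff algebra_simps)

lemma vscale_add_left: "vscale (a + b) x = vscale a x + vscale b x"
  by (auto simp: vscale_def fun_eq_iff algebra_simps)

lemma vscale_vscale: "vscale a (vscale b x) = vscale (a * b) x"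
  by (auto simp: vscale_def fun_eq_iff algebra_simps)

lemma vscale_add: "vscale a (x + y) = vscale a x + vscale a y"
  by (auto simp: vscale_def fun_eq_iff algebra_simps)

lemma lmap_scalar_ext_add:
  "lmap (scalar_ext Q V) \<alpha> (x + y) = lmap (scalar_ext Q V) \<alpha> x + lmap (scalar_ext Q V) \<alpha> y"
  by (simp add: scalar_ext_def vscale_add_left sum.distrib)

lemma lmap_scalar_ext_scale:
  "lmap (scalar_ext Q V) \<alpha> (vscale c x) = vscale c (lmap (scalar_ext Q V) \<alpha> x)"
  unfolding scalar_ext_def by (simp add: vscale_sum vscale_vscale) (simp add: vscale_def)

lemma free_space_sum:
  "(\<And>a. a \<in> A \<Longrightarrow> f a \<in> free_space S) \<Longrightarrow> sum f A \<in> free_space S"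
  by (induction A rule: infinite_finite_induct) (auto simp: free_space_def)

lemma lmap_scalar_ext_in:
  assumes "f1_representation Q V" "\<alpha> \<in> arcs Q"
  shows "lmap (scalar_ext Q V) \<alpha> x \<in> space (scalar_ext Q V) (head Q \<alpha>)"
proof -
  have "act V \<alpha> v \<in> pts V (head Q \<alpha>)" if "v \<in> pts V (tail Q \<alpha>)" for v
    using assms that by (auto simp: f1_representation_def f1_linear_def)
  then have "vscale (x v) (if act V \<alpha> v = base V (head Q \<alpha>) then 0 else gen (act V \<alpha> v))
               \<in> free_space (nonzero V (head Q \<alpha>))" if "v \<in> nonzero V (tail Q \<alpha>)" for v
    using that by (auto simp: free_space_def vscale_def gen_def)
  then show ?thesis
    unfolding scalar_ext_def by (auto intro: free_space_sum)
qed

lemma subspace_rep_hom: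
  "module.subspace fam_scale
     (rep_hom Q (scalar_ext Q V) (scalar_ext Q W) :: ('q \<Rightarrow> ('v \<Rightarrow> 'k::field) \<Rightarrow> ('w \<Rightarrow> 'k)) set)"
proof -
  interpret vector_space "fam_scale :: 'k \<Rightarrow> ('q \<Rightarrow> ('v \<Rightarrow> 'k) \<Rightarrow> ('w \<Rightarrow> 'k)) \<Rightarrow> _"
    by (rule vector_space_fam_scale)
  have l0: "lmap (scalar_ext Q W) \<alpha> 0 = 0" for \<alpha>
    using lmap_scalar_ext_add[of Q W \<alpha> 0 0] by simp
  have sp: "space (scalar_ext Q U) i = free_space (nonzero U i)" for U :: "('q,'a,'u) f1_rep" and i
    by (simp add: scalar_ext_def)
  have sp0: "0 \<in> space (scalar_ext Q W) i"
    and spa: "x \<in> space (scalar_ext Q W) i \<Longrightarrow> y \<in> space (scalar_ext Q W) i \<Longrightarrow> x + y \<in> space (scalar_ext Q W) i"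
    and sps: "x \<in> space (scalar_ext Q W) i \<Longrightarrow> vscale c x \<in> space (scalar_ext Q W) i"
    for x y :: "'w \<Rightarrow> 'k" and i c
    by (auto simp: scalar_ext_def free_space_def vscale_def)
  show ?thesis
    unfolding subspace_def
  proof (intro conjI ballI allI)
    show "0 \<in> rep_hom Q (scalar_ext Q V) (scalar_ext Q W)"
      using sp0 by (auto simp: rep_hom_def hom_prod_def hom_K_def l0)
  next
    fix f g :: "'q \<Rightarrow> ('v \<Rightarrow> 'k) \<Rightarrow> ('w \<Rightarrow> 'k)"
    assume "f \<in> rep_hom Q (scalar_ext Q V) (scalar_ext Q W)"
      and "g \<in> rep_hom Q (scalar_ext Q V) (scalar_ext Q W)"
    then show "f + g \<in> rep_hom Q (scalar_ext Q V) (scalar_ext Q W)"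
      by (auto simp: rep_hom_def hom_prod_def hom_K_def spa lmap_scalar_ext_add vscale_add)
  next
    fix c and f :: "'q \<Rightarrow> ('v \<Rightarrow> 'k) \<Rightarrow> ('w \<Rightarrow> 'k)"
    assume "f \<in> rep_hom Q (scalar_ext Q V) (scalar_ext Q W)"
    then show "fam_scale c f \<in> rep_hom Q (scalar_ext Q V) (scalar_ext Q W)"
      by (auto simp: rep_hom_def hom_prod_def hom_K_def fam_scale_def sps lmap_scalar_ext_scale
           vscale_add vscale_vscale mult.commute)
  qed
qed

lemma b_elem_in_hom_prod:
  assumes "i \<in> verts Q" "v \<in> nonzero V i" "w \<in> nonzero W i"
  shows "b_elem V (i, v) (i, w) \<in> hom_prod Q (scalar_ext Q V) (scalar_ext Q W)"
  using assms
  by (auto simp: b_elem_def hom_prod_def hom_K_def scalar_ext_def free_space_def vscale_def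
      gen_def fun_eq_iff algebra_simps)

lemma b_elem_gen:
  assumes "v' \<in> nonzero V i"
  shows "b_elem V (i, v) (i, w) i (gen v') = (if v = v' then gen w else 0)"
  using assms by (auto simp: b_elem_def free_space_def vscale_def gen_def fun_eq_iff)

lemma wf_digraph_coeff_quiver: "wf_digraph (coeff_quiver Q V)"
  by unfold_locales (auto simp: coeff_quiver_def)

lemma wf_digraph_tensor_coeff_quiver:
  "wf_digraph (tensor_coeff_quiver Q V W)"
  by unfold_locales (auto simp: tensor_coeff_quiver_def coeff_quiver_def)

context
  fixes Q :: "('q, 'a) pre_digraph" and V :: "('q, 'a, 'v) f1_rep" and W :: "('q, 'a, 'w) f1_rep"
  assumes wfQ: "wf_digraph Q"
    and V: "f1_representation Q V" and W: "f1_representation Q W"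
begin

lemma base_in: "i \<in> verts Q \<Longrightarrow> base V i \<in> pts V i" "i \<in> verts Q \<Longrightarrow> base W i \<in> pts W i"
  using V W by (auto simp: f1_representation_def f1_vector_space_def)

lemma act_in:
  "\<alpha> \<in> arcs Q \<Longrightarrow> v \<in> pts V (tail Q \<alpha>) \<Longrightarrow> act V \<alpha> v \<in> pts V (head Q \<alpha>)"
  "\<alpha> \<in> arcs Q \<Longrightarrow> w \<in> pts W (tail Q \<alpha>) \<Longrightarrow> act W \<alpha> w \<in> pts W (head Q \<alpha>)"
  using V W unfolding f1_representation_def f1_linear_def by blast+

lemma act_base:
  "\<alpha> \<in> arcs Q \<Longrightarrow> act V \<alpha> (base V (tail Q \<alpha>)) = base V (head Q \<alpha>)"
  "\<alpha> \<in> arcs Q \<Longrightarrow> act W \<alpha> (base W (tail Q \<alpha>)) = base W (head Q \<alpha>)"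
  using V W by (auto simp: f1_representation_def f1_linear_def)

lemma act_inj:
  "\<alpha> \<in> arcs Q \<Longrightarrow> v \<in> pts V (tail Q \<alpha>) \<Longrightarrow> v' \<in> pts V (tail Q \<alpha>) \<Longrightarrow>
    act V \<alpha> v = act V \<alpha> v' \<Longrightarrow> act V \<alpha> v \<noteq> base V (head Q \<alpha>) \<Longrightarrow> v = v'"
  "\<alpha> \<in> arcs Q \<Longrightarrow> w \<in> pts W (tail Q \<alpha>) \<Longrightarrow> w' \<in> pts W (tail Q \<alpha>) \<Longrightarrow>
    act W \<alpha> w = act W \<alpha> w' \<Longrightarrow> act W \<alpha> w \<noteq> base W (head Q \<alpha>) \<Longrightarrow> w = w'"
proof -
  assume a: "\<alpha> \<in> arcs Q"
  have iV: "inj_on (act V \<alpha>) (pts V (tail Q \<alpha>) - act V \<alpha> -` {base V (head Q \<alpha>)})"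
    and iW: "inj_on (act W \<alpha>) (pts W (tail Q \<alpha>) - act W \<alpha> -` {base W (head Q \<alpha>)})"
    using V W a unfolding f1_representation_def f1_linear_def by blast+
  show "v = v'" if "v \<in> pts V (tail Q \<alpha>)" "v' \<in> pts V (tail Q \<alpha>)"
    "act V \<alpha> v = act V \<alpha> v'" "act V \<alpha> v \<noteq> base V (head Q \<alpha>)"
    by (rule inj_onD[OF iV]) (use that in auto)
  show "w = w'" if "w \<in> pts W (tail Q \<alpha>)" "w' \<in> pts W (tail Q \<alpha>)"
    "act W \<alpha> w = act W \<alpha> w'" "act W \<alpha> w \<noteq> base W (head Q \<alpha>)"
    by (rule inj_onD[OF iW]) (use that in auto)
qed

lemma tensor_elem_nonzero:
  assumes "v \<in> nonzero V i" "w \<in> nonzero W i"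
  shows "tensor_elem V W i v w = {(v, w)}"
  using assms by (auto simp: tensor_elem_def collapse_rel_def collapsed_def)

lemma tensor_elem_zero:
  assumes "i \<in> verts Q" "v \<in> pts V i" "w \<in> pts W i" "v = base V i \<or> w = base W i"
  shows "tensor_elem V W i v w = collapsed V W i"
  using assms base_in[of i] by (auto simp: tensor_elem_def collapse_rel_def collapsed_def)

lemma pts_tensor:
  assumes "i \<in> verts Q"
  shows "pts (tensor_rep Q V W) i =
           insert (collapsed V W i) ((\<lambda>p. {p}) ` (nonzero V i \<times> nonzero W i))"
proof -
  have "pts (tensor_rep Q V W) i = (\<lambda>(v, w). tensor_elem V W i v w) ` (pts V i \<times> pts W i)"
    by (auto simp: tensor_rep_def quotient_def tensor_elem_def)
  also have "\<dots> = insert (collapsed V W i) ((\<lambda>p. {p}) ` (nonzero V i \<times> nonzero W i))"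
    (is "?L = ?R")
  proof
    show "?L \<subseteq> ?R"
    proof
      fix X assume "X \<in> ?L"
      then obtain v w where vw: "v \<in> pts V i" "w \<in> pts W i" "X = tensor_elem V W i v w"
        by auto
      show "X \<in> ?R"
      proof (cases "v = base V i \<or> w = base W i")
        case True
        then show ?thesis using vw tensor_elem_zero[OF assms] by auto
      next
        case False
        then show ?thesis using vw tensor_elem_nonzero[of v i w] by auto
      qed
    qed
    have "collapsed V W i \<in> ?L"
      using base_in[OF assms] tensor_elem_zero[OF assms base_in[OF assms]]
      by (force simp: image_iff)
    moreover have "(\<lambda>p. {p}) ` (nonzero V i \<times> nonzero W i) \<subseteq> ?L"
    proof
      fix X assume "X \<in> (\<lambda>p. {p}) ` (nonzero V i \<times> nonzero W i)"
      then obtain v w where vw: "v \<in> nonzero V i" "w \<in> nonzero W i" "X = {(v, w)}" by auto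
      then have "X = (\<lambda>(v, w). tensor_elem V W i v w) (v, w)"
        using tensor_elem_nonzero by auto
      then show "X \<in> ?L" using vw by blast
    qed
    ultimately show "?R \<subseteq> ?L" by (simp only: insert_subset)
  qed
  finally show ?thesis .
qed

lemma base_tensor: "i \<in> verts Q \<Longrightarrow> base (tensor_rep Q V W) i = collapsed V W i"
  using tensor_elem_zero base_in by (simp add: tensor_rep_def)

lemma nonzero_tensor:
  assumes "i \<in> verts Q"
  shows "nonzero (tensor_rep Q V W) i = (\<lambda>p. {p}) ` (nonzero V i \<times> nonzero W i)"
proof -
  have "(base V i, base W i) \<in> collapsed V W i"
    using base_in[OF assms] by (auto simp: collapsed_def)
  then have "collapsed V W i \<notin> (\<lambda>p. {p}) ` (nonzero V i \<times> nonzero W i)" by auto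
  then show ?thesis using pts_tensor[OF assms] base_tensor[OF assms] by auto
qed

text \<open>The arrow \<open>\<alpha>\<close> sends \<open>v \<otimes> w\<close> to \<open>V\<^sub>\<alpha>(v) \<otimes> W\<^sub>\<alpha>(w)\<close>.\<close>

lemma act_tensor_elem:
  assumes "\<alpha> \<in> arcs Q" "v \<in> pts V (tail Q \<alpha>)" "w \<in> pts W (tail Q \<alpha>)"
  shows "act (tensor_rep Q V W) \<alpha> (tensor_elem V W (tail Q \<alpha>) v w) =
         tensor_elem V W (head Q \<alpha>) (act V \<alpha> v) (act W \<alpha> w)"
proof (cases "v = base V (tail Q \<alpha>) \<or> w = base W (tail Q \<alpha>)")
  case True
  have t: "tail Q \<alpha> \<in> verts Q" and h: "head Q \<alpha> \<in> verts Q"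
    using wfQ assms by (auto simp: wf_digraph_def)
  have z: "tensor_elem V W (head Q \<alpha>) (act V \<alpha> x) (act W \<alpha> y) = collapsed V W (head Q \<alpha>)"
    if "(x, y) \<in> collapsed V W (tail Q \<alpha>)" for x y
    by (rule tensor_elem_zero[OF h])
       (use that assms(1) act_in act_base base_in[OF t] in \<open>auto simp: collapsed_def\<close>)
  have ne: "(v, w) \<in> collapsed V W (tail Q \<alpha>)" using True assms by (auto simp: collapsed_def)
  have "(\<lambda>(v, w). tensor_elem V W (head Q \<alpha>) (act V \<alpha> v) (act W \<alpha> w)) ` collapsed V W (tail Q \<alpha>)
          = {collapsed V W (head Q \<alpha>)}"
    using z ne by (auto simp: image_iff) (metis case_prod_conv)
  then show ?thesis
    using tensor_elem_zero[OF t assms(2,3) True] z[OF ne] by (simp add: tensor_rep_def)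
next
  case False
  then show ?thesis using assms tensor_elem_nonzero[of v "tail Q \<alpha>" w] by (simp add: tensor_rep_def)
qed

lemma tensor_wf: "\<alpha> \<in> arcs Q \<Longrightarrow> tail Q \<alpha> \<in> verts Q" "\<alpha> \<in> arcs Q \<Longrightarrow> head Q \<alpha> \<in> verts Q"
  using wfQ by (auto simp: wf_digraph_def)

lemma act_tensor_single:
  assumes a: "\<alpha> \<in> arcs Q" "v \<in> nonzero V (tail Q \<alpha>)" "w \<in> nonzero W (tail Q \<alpha>)"
  shows "act (tensor_rep Q V W) \<alpha> {(v, w)} =
           (if act V \<alpha> v = base V (head Q \<alpha>) \<or> act W \<alpha> w = base W (head Q \<alpha>)
            then base (tensor_rep Q V W) (head Q \<alpha>) else {(act V \<alpha> v, act W \<alpha> w)})"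
proof -
  have h: "head Q \<alpha> \<in> verts Q" using tensor_wf a by auto
  have e: "act (tensor_rep Q V W) \<alpha> {(v, w)} = tensor_elem V W (head Q \<alpha>) (act V \<alpha> v) (act W \<alpha> w)"
    using act_tensor_elem[of \<alpha> v w] tensor_elem_nonzero[of v "tail Q \<alpha>" w] a by simp
  have p: "act V \<alpha> v \<in> pts V (head Q \<alpha>)" "act W \<alpha> w \<in> pts W (head Q \<alpha>)"
    using act_in a by auto
  show ?thesis
    using e p tensor_elem_nonzero tensor_elem_zero[OF h p] base_tensor[OF h] by auto
qed

lemma act_tensor_single_nonzero:
  assumes a: "\<alpha> \<in> arcs Q" "v \<in> nonzero V (tail Q \<alpha>)" "w \<in> nonzero W (tail Q \<alpha>)"
  shows "act (tensor_rep Q V W) \<alpha> {(v, w)} \<in> nonzero (tensor_rep Q V W) (head Q \<alpha>) \<longleftrightarrow>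
           act V \<alpha> v \<noteq> base V (head Q \<alpha>) \<and> act W \<alpha> w \<noteq> base W (head Q \<alpha>)"
proof -
  have h: "head Q \<alpha> \<in> verts Q" using tensor_wf a by auto
  have p: "act V \<alpha> v \<in> pts V (head Q \<alpha>)" "act W \<alpha> w \<in> pts W (head Q \<alpha>)"
    using act_in a by auto
  show ?thesis
    unfolding nonzero_tensor[OF h] act_tensor_single[OF a]
    using p nonzero_tensor[OF h] by auto
qed

lemma act_tensor_base:
  assumes "\<alpha> \<in> arcs Q"
  shows "act (tensor_rep Q V W) \<alpha> (base (tensor_rep Q V W) (tail Q \<alpha>)) =
         base (tensor_rep Q V W) (head Q \<alpha>)"
proof -
  have "act (tensor_rep Q V W) \<alpha>
      (tensor_elem V W (tail Q \<alpha>) (base V (tail Q \<alpha>)) (base W (tail Q \<alpha>))) =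
    tensor_elem V W (head Q \<alpha>) (base V (head Q \<alpha>)) (base W (head Q \<alpha>))"
    using act_tensor_elem[OF assms base_in(1) base_in(2)] act_base[OF assms] tensor_wf[OF assms]
    by simp
  then show ?thesis by (simp add: tensor_rep_def)
qed

lemma f1_representation_tensor: "f1_representation Q (tensor_rep Q V W)"
proof -
  let ?T = "tensor_rep Q V W"
  have "f1_vector_space (pts ?T i) (base ?T i)" if "i \<in> verts Q" for i
  proof -
    have "finite (pts V i)" "finite (pts W i)"
      using V W that by (auto simp: f1_representation_def f1_vector_space_def)
    then show ?thesis
      using pts_tensor[OF that] base_tensor[OF that] by (simp add: f1_vector_space_def)
  qed
  moreover have "f1_linear (pts ?T (tail Q \<alpha>)) (base ?T (tail Q \<alpha>))
                   (pts ?T (head Q \<alpha>)) (base ?T (head Q \<alpha>)) (act ?T \<alpha>)"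
    if a: "\<alpha> \<in> arcs Q" for \<alpha>
  proof -
    have b: "base ?T (head Q \<alpha>) \<in> pts ?T (head Q \<alpha>)"
      using pts_tensor base_tensor tensor_wf[OF a] by simp
    have c: "X = base ?T (tail Q \<alpha>) \<or>
        (\<exists>v w. X = {(v, w)} \<and> v \<in> nonzero V (tail Q \<alpha>) \<and> w \<in> nonzero W (tail Q \<alpha>))"
      if "X \<in> pts ?T (tail Q \<alpha>)" for X
      using that pts_tensor[OF tensor_wf(1)[OF a]] base_tensor[OF tensor_wf(1)[OF a]] by auto
    have s: "{(act V \<alpha> v, act W \<alpha> w)} \<in> pts ?T (head Q \<alpha>)"
      if "v \<in> nonzero V (tail Q \<alpha>)" "w \<in> nonzero W (tail Q \<alpha>)"
        "act V \<alpha> v \<noteq> base V (head Q \<alpha>)" "act W \<alpha> w \<noteq> base W (head Q \<alpha>)" for v w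
      using act_tensor_single_nonzero[OF a that(1,2)] act_tensor_single[OF a that(1,2)] that(3,4)
      by auto
    have "act ?T \<alpha> X \<in> pts ?T (head Q \<alpha>)" if X: "X \<in> pts ?T (tail Q \<alpha>)" for X
      using c[OF X]
    proof (elim disjE exE conjE)
      assume "X = base ?T (tail Q \<alpha>)"
      then show ?thesis using act_tensor_base[OF a] b by simp
    next
      fix v w assume "X = {(v, w)}" "v \<in> nonzero V (tail Q \<alpha>)" "w \<in> nonzero W (tail Q \<alpha>)"
      then show ?thesis using act_tensor_single[OF a, of v w] b s by simp
    qed
    moreover have "inj_on (act ?T \<alpha>) (pts ?T (tail Q \<alpha>) - act ?T \<alpha> -` {base ?T (head Q \<alpha>)})"
    proof (rule inj_onI)
      fix X Y
      assume X: "X \<in> pts ?T (tail Q \<alpha>) - act ?T \<alpha> -` {base ?T (head Q \<alpha>)}"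
        and Y: "Y \<in> pts ?T (tail Q \<alpha>) - act ?T \<alpha> -` {base ?T (head Q \<alpha>)}"
        and eq: "act ?T \<alpha> X = act ?T \<alpha> Y"
      obtain v w where vw: "X = {(v, w)}" "v \<in> nonzero V (tail Q \<alpha>)" "w \<in> nonzero W (tail Q \<alpha>)"
        using X c[of X] act_tensor_base[OF a] by auto
      obtain v' w' where vw': "Y = {(v', w')}" "v' \<in> nonzero V (tail Q \<alpha>)" "w' \<in> nonzero W (tail Q \<alpha>)"
        using Y c[of Y] act_tensor_base[OF a] by auto
      have "act ?T \<alpha> {(v, w)} \<noteq> base ?T (head Q \<alpha>)"
        using X vw(1) by simp
      then have n: "act V \<alpha> v \<noteq> base V (head Q \<alpha>)" "act W \<alpha> w \<noteq> base W (head Q \<alpha>)"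
        unfolding act_tensor_single[OF a vw(2,3)] by presburger+
      have "act ?T \<alpha> {(v', w')} \<noteq> base ?T (head Q \<alpha>)"
        using Y vw'(1) by simp
      then have n': "act V \<alpha> v' \<noteq> base V (head Q \<alpha>)" "act W \<alpha> w' \<noteq> base W (head Q \<alpha>)"
        unfolding act_tensor_single[OF a vw'(2,3)] by presburger+
      have fX: "act ?T \<alpha> X = {(act V \<alpha> v, act W \<alpha> w)}"
        unfolding vw(1) act_tensor_single[OF a vw(2,3)] using n by (simp only: if_False simp_thms)
      have fY: "act ?T \<alpha> Y = {(act V \<alpha> v', act W \<alpha> w')}"
        unfolding vw'(1) act_tensor_single[OF a vw'(2,3)] using n' by (simp only: if_False simp_thms)
      have "{(act V \<alpha> v, act W \<alpha> w)} = {(act V \<alpha> v', act W \<alpha> w')}"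
        using eq unfolding fX fY .
      then have e: "act V \<alpha> v = act V \<alpha> v'" "act W \<alpha> w = act W \<alpha> w'"
        by blast+
      have "v = v'"
        by (rule act_inj(1)[OF a _ _ e(1) n(1)]) (use vw vw' in auto)
      moreover have "w = w'"
        by (rule act_inj(2)[OF a _ _ e(2) n(2)]) (use vw vw' in auto)
      ultimately show "X = Y" unfolding vw(1) vw'(1) by simp
    qed
    ultimately show ?thesis
      using act_tensor_base[OF a] unfolding f1_linear_def by blast
  qed
  ultimately show ?thesis unfolding f1_representation_def by blast
qed

text \<open>
  The identification sends \<open>((i, v), (i, w))\<close> to \<open>(i, v \<otimes> w)\<close>, where \<open>v \<otimes> w\<close> is the class
  \<open>{(v, w)}\<close>, and is compatible with the quiver morphisms to \<open>Q\<close>.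
\<close>

lemma coeff_quiver_tensor:
  defines "\<phi> \<equiv> (\<lambda>((i, v), (j, w)). (i, {(v, w)})) ::
             ('q \<times> 'v) \<times> ('q \<times> 'w) \<Rightarrow> 'q \<times> ('v \<times> 'w) set"
  defines "\<psi> \<equiv> (\<lambda>((\<alpha>, x, y), (\<beta>, x', y')). (\<alpha>, \<phi> (x, x'), \<phi> (y, y'))) ::
             ('a \<times> ('q \<times> 'v) \<times> ('q \<times> 'v)) \<times> ('a \<times> ('q \<times> 'w) \<times> ('q \<times> 'w)) \<Rightarrow>
             'a \<times> ('q \<times> ('v \<times> 'w) set) \<times> ('q \<times> ('v \<times> 'w) set)"
  defines "H \<equiv> coeff_quiver Q (tensor_rep Q V W)"
  defines "f \<equiv> \<lparr>iso_verts = \<phi>, iso_arcs = \<psi>, iso_head = head H, iso_tail = tail H\<rparr>"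
  shows "pre_digraph.digraph_isomorphism (tensor_coeff_quiver Q V W) f"
    and "app_iso f (tensor_coeff_quiver Q V W) = H"
proof -
  let ?G = "tensor_coeff_quiver Q V W"
  let ?T = "tensor_rep Q V W"
  define P where "P = (\<lambda>\<alpha> v w. \<alpha> \<in> arcs Q \<and> v \<in> nonzero V (tail Q \<alpha>) \<and> w \<in> nonzero W (tail Q \<alpha>) \<and>
        act V \<alpha> v \<noteq> base V (head Q \<alpha>) \<and> act W \<alpha> w \<noteq> base W (head Q \<alpha>))"
  have wfG: "wf_digraph ?G" by (rule wf_digraph_tensor_coeff_quiver)
  have vs: "verts ?G = {((i, v), (i, w)) | i v w. i \<in> verts Q \<and> v \<in> nonzero V i \<and> w \<in> nonzero W i}"
    by (auto simp: tensor_coeff_quiver_def coeff_quiver_def)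
  have as: "arcs ?G = {((\<alpha>, (tail Q \<alpha>, v), (head Q \<alpha>, act V \<alpha> v)), (\<alpha>, (tail Q \<alpha>, w), (head Q \<alpha>, act W \<alpha> w)))
      | \<alpha> v w. P \<alpha> v w}" (is "_ = ?A")
    using tensor_wf act_in
    by (auto simp: tensor_coeff_quiver_def coeff_quiver_def P_def)
  have ah: "arcs H = {(\<alpha>, (tail Q \<alpha>, {(v, w)}), (head Q \<alpha>, {(act V \<alpha> v, act W \<alpha> w)}))
      | \<alpha> v w. P \<alpha> v w}" (is "_ = ?B")
  proof
    show "arcs H \<subseteq> ?B"
    proof
      fix e assume "e \<in> arcs H"
      then obtain \<alpha> X where e: "e = (\<alpha>, (tail Q \<alpha>, X), (head Q \<alpha>, act ?T \<alpha> X))" "\<alpha> \<in> arcs Q"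
          "X \<in> nonzero ?T (tail Q \<alpha>)" "act ?T \<alpha> X \<in> nonzero ?T (head Q \<alpha>)"
        by (auto simp: H_def coeff_quiver_def)
      then obtain v w where X: "X = {(v, w)}" and vw: "v \<in> nonzero V (tail Q \<alpha>)" "w \<in> nonzero W (tail Q \<alpha>)"
        using nonzero_tensor[OF tensor_wf(1)[OF e(2)]] by auto
      have n: "act V \<alpha> v \<noteq> base V (head Q \<alpha>) \<and> act W \<alpha> w \<noteq> base W (head Q \<alpha>)"
        using act_tensor_single_nonzero[OF e(2) vw] e(4) X by simp
      then have "P \<alpha> v w" using e(2) vw by (simp add: P_def)
      moreover have "act ?T \<alpha> X = {(act V \<alpha> v, act W \<alpha> w)}"
        using act_tensor_single[OF e(2) vw] n X by simp
      ultimately show "e \<in> ?B" using e(1) X by blast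
    qed
  next
    show "?B \<subseteq> arcs H"
    proof
      fix e assume "e \<in> ?B"
      then obtain \<alpha> v w where e: "e = (\<alpha>, (tail Q \<alpha>, {(v, w)}), (head Q \<alpha>, {(act V \<alpha> v, act W \<alpha> w)}))"
        and p: "P \<alpha> v w" by blast
      have a: "\<alpha> \<in> arcs Q" and vw: "v \<in> nonzero V (tail Q \<alpha>)" "w \<in> nonzero W (tail Q \<alpha>)"
        and n: "act V \<alpha> v \<noteq> base V (head Q \<alpha>)" "act W \<alpha> w \<noteq> base W (head Q \<alpha>)"
        using p by (auto simp: P_def)
      have "{(v, w)} \<in> nonzero ?T (tail Q \<alpha>)"
        using nonzero_tensor[OF tensor_wf(1)[OF a]] vw by auto
      moreover have "act ?T \<alpha> {(v, w)} = {(act V \<alpha> v, act W \<alpha> w)}"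
        using act_tensor_single[OF a vw] n by simp
      moreover have "act ?T \<alpha> {(v, w)} \<in> nonzero ?T (head Q \<alpha>)"
        using act_tensor_single_nonzero[OF a vw] n by simp
      ultimately show "e \<in> arcs H"
        using e a tensor_wf[OF a] by (simp add: H_def coeff_quiver_def)
    qed
  qed
  show "pre_digraph.digraph_isomorphism ?G f"
    unfolding pre_digraph.digraph_isomorphism_def
  proof (intro conjI ballI wfG)
    show "inj_on (iso_verts f) (verts ?G)"
      unfolding vs f_def by (auto simp: inj_on_def \<phi>_def)
    show "inj_on (iso_arcs f) (arcs ?G)"
      unfolding as f_def by (auto simp: inj_on_def \<phi>_def \<psi>_def)
  next
    fix a assume "a \<in> arcs ?G"
    then show "iso_verts f (tail ?G a) = iso_tail f (iso_arcs f a)"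
      "iso_verts f (head ?G a) = iso_head f (iso_arcs f a)"
      unfolding as by (auto simp: f_def H_def \<psi>_def coeff_quiver_def tensor_coeff_quiver_def)
  qed
  have vH: "verts H = \<phi> ` verts ?G"
  proof -
    have "verts H = {(i, {(v, w)}) | i v w. i \<in> verts Q \<and> v \<in> nonzero V i \<and> w \<in> nonzero W i}"
    proof -
      have "verts H = Sigma (verts Q) (nonzero ?T)" by (simp add: H_def coeff_quiver_def)
      also have "\<dots> = Sigma (verts Q) (\<lambda>i. (\<lambda>p. {p}) ` (nonzero V i \<times> nonzero W i))"
        using nonzero_tensor by (intro Sigma_cong) auto
      finally show ?thesis by auto
    qed
    also have "\<dots> = \<phi> ` verts ?G"
      unfolding vs by (force simp: \<phi>_def)
    finally show ?thesis .
  qed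
  have "?B = \<psi> ` ?A"
  proof
    show "?B \<subseteq> \<psi> ` ?A"
    proof
      fix e assume "e \<in> ?B"
      then obtain \<alpha> v w where e: "e = (\<alpha>, (tail Q \<alpha>, {(v, w)}), (head Q \<alpha>, {(act V \<alpha> v, act W \<alpha> w)}))"
        and p: "P \<alpha> v w" by blast
      show "e \<in> \<psi> ` ?A"
        by (rule image_eqI[where x = "((\<alpha>, (tail Q \<alpha>, v), (head Q \<alpha>, act V \<alpha> v)),
              (\<alpha>, (tail Q \<alpha>, w), (head Q \<alpha>, act W \<alpha> w)))"])
           (use e p in \<open>auto simp: \<phi>_def \<psi>_def\<close>)
    qed
    show "\<psi> ` ?A \<subseteq> ?B" by (auto simp: \<phi>_def \<psi>_def)
  qed
  then have aH: "arcs H = \<psi> ` arcs ?G" using ah as by simp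
  show "app_iso f ?G = H"
    by (rule pre_digraph.equality) (simp_all add: vH aH f_def)
qed

end

end

theory Submission
  imports Defs
begin

text \<open>
  A family \<open>f\<close> of linear maps \<open>V\<^sub>i\<^sup>K \<rightarrow> W\<^sub>i\<^sup>K\<close> is the same thing as a function
  \<open>m\<close> on the vertices of the coefficient quiver \<open>G\<close> of \<open>V \<otimes> W\<close>: its matrix entries, with
  \<open>f v = \<Sum>w. m (v, w) w\<close>. Evaluating the commutation relation for an arrow \<open>\<alpha>\<close> at a basis vector
  \<open>v\<close> and comparing coefficients gives

  \<open>\<Sum>w'. m (V\<^sub>\<alpha> v, w') w' = \<Sum>w. m (v, w) W\<^sub>\<alpha> w\<close>,

  where the left-hand side is \<open>0\<close> if \<open>V\<^sub>\<alpha> v = 0\<close>. Since \<open>W\<^sub>\<alpha>\<close> is injective off its kernel, each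
  coefficient of either side is a single value of \<open>m\<close> or \<open>0\<close>, and there are three kinds of
  conditions: \<open>m\<close> takes the same value at the two ends of each arrow of \<open>G\<close>; it vanishes at
  \<open>(v, w)\<close> if \<open>W\<^sub>\<alpha> w \<noteq> 0\<close> but \<open>V\<^sub>\<alpha> v = 0\<close>; and it vanishes at \<open>(V\<^sub>\<alpha> v, w')\<close> if \<open>w'\<close> is not in
  the image of \<open>W\<^sub>\<alpha>\<close>. The last two say that \<open>m\<close> vanishes where reflection of successors or
  induction of predecessors fails (\<open>rep_hom_iff_entries\<close>).

  Hence the homomorphisms correspond to the functions that are constant on each connected component
  of \<open>G\<close> and zero on the inadmissible ones. The indicator functions of the admissible components
  are a basis of these, and they are the entries of the maps \<open>b\<^sup>C\<close> (\<open>entry_b_comp\<close>). What this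
  needs of the components, which are defined as maximal connected subgraphs, is that they partition
  the vertices and that no arrow enters or leaves one of them.
\<close>

section \<open>Connected components\<close>

text \<open>
  Connectedness restated without walks: the vertices that undirected walks reach from a given one
  form a set that no arrow enters or leaves. In this form connectedness passes easily to unions, and functions that are
  invariant along arrows are constant because their level sets are closed.
\<close>

lemma connected_iff_no_closed_subset:
  assumes "wf_digraph G"
  shows "connected G \<longleftrightarrow> verts G \<noteq> {} \<and>
    (\<forall>S. S \<subseteq> verts G \<and> S \<noteq> {} \<and> (\<forall>e \<in> arcs G. tail G e \<in> S \<longleftrightarrow> head G e \<in> S) \<longrightarrow> S = verts G)"
    (is "?L \<longleftrightarrow> ?R")
proof
  assume L: ?L
  have "S = verts G"
    if S: "S \<subseteq> verts G" "S \<noteq> {}" "\<forall>e \<in> arcs G. tail G e \<in> S \<longleftrightarrow> head G e \<in> S" for S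
  proof -
    obtain u where u: "u \<in> S" using S(2) by blast
    have "v \<in> S" if v: "v \<in> verts G" for v
    proof -
      have "(u, v) \<in> rtrancl_on (verts G) ((arcs_ends G)\<^sup>s)"
        using L u v S(1) unfolding connected_conv by blast
      then show ?thesis
      proof (induction rule: rtrancl_on_induct)
        case base
        show ?case by (rule u)
      next
        case (step y z)
        then show ?case using S(3) by (auto simp: symcl_def arcs_ends_conv)
      qed
    qed
    then show ?thesis using S(1) by blast
  qed
  then show ?R using L unfolding connected_conv by blast
next
  assume R: ?R
  have "(u, v) \<in> rtrancl_on (verts G) ((arcs_ends G)\<^sup>s)"
    if uv: "u \<in> verts G" "v \<in> verts G" for u v
  proof -
    let ?r = "rtrancl_on (verts G) ((arcs_ends G)\<^sup>s)"
    let ?S = "{w. (u, w) \<in> ?r}"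
    have "?S \<subseteq> verts G" by (auto dest: in_rtrancl_on_in_F)
    moreover have "u \<in> ?S" using uv by simp
    moreover have "tail G e \<in> ?S \<longleftrightarrow> head G e \<in> ?S" if e: "e \<in> arcs G" for e
    proof -
      have "(tail G e, head G e) \<in> (arcs_ends G)\<^sup>s" "(head G e, tail G e) \<in> (arcs_ends G)\<^sup>s"
        using e by (force simp: symcl_def arcs_ends_conv)+
      moreover have "tail G e \<in> verts G" "head G e \<in> verts G"
        using assms e by (auto simp: wf_digraph_def)
      ultimately show ?thesis by (blast intro: rtrancl_on_into_rtrancl_on)
    qed
    ultimately have "?S = verts G" using R by blast
    then show ?thesis using uv by blast
  qed
  then show ?L using R unfolding connected_conv by blast
qed

lemma connected_no_closed_subset:
  assumes "wf_digraph G" "connected G" "S \<subseteq> verts G" "S \<noteq> {}"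
    and "\<forall>e \<in> arcs G. tail G e \<in> S \<longleftrightarrow> head G e \<in> S"
  shows "S = verts G"
  using iffD1[OF connected_iff_no_closed_subset[OF assms(1)] assms(2)] assms(3-5) by simp

lemma constant_on_connected:
  assumes "wf_digraph G" "connected G"
    and "\<And>e. e \<in> arcs G \<Longrightarrow> m (tail G e) = m (head G e)"
    and "x \<in> verts G" "y \<in> verts G"
  shows "m x = m y"
proof -
  let ?S = "{z \<in> verts G. m z = m x}"
  have "?S \<noteq> {}" using assms(4) by blast
  moreover have "\<forall>e \<in> arcs G. tail G e \<in> ?S \<longleftrightarrow> head G e \<in> ?S"
    using assms(1,3) by (auto simp: wf_digraph_def)
  ultimately have "?S = verts G"
    by (intro connected_no_closed_subset[OF assms(1,2)]) auto
  then show ?thesis using assms(5) by force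
qed

lemma subgraph_antisym: "subgraph G H \<Longrightarrow> subgraph H G \<Longrightarrow> G = H"
  by (rule pre_digraph.equality) (auto simp: subgraph_def compatible_def)

context wf_digraph
begin

lemma subgraph_Union:
  assumes "\<And>H. H \<in> \<H> \<Longrightarrow> subgraph H G"
  shows "subgraph (Union \<H>) G" and "H \<in> \<H> \<Longrightarrow> subgraph H (Union \<H>)"
proof -
  have wf: "wf_digraph (Union \<H>)"
    using assms by unfold_locales (fastforce simp: Union_def subgraph_def compatible_def wf_digraph_def)+
  then show "subgraph (Union \<H>) G"
    using assms by (auto simp: Union_def subgraph_def compatible_def wf_digraph_axioms)
  show "subgraph H (Union \<H>)" if "H \<in> \<H>"
    using assms[OF that] that wf by (auto simp: Union_def subgraph_def compatible_def)
qed

text \<open>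
  The common vertex \<open>x\<close> ties the members together: a closed set that meets one member contains it,
  thus contains \<open>x\<close>, and then contains every member.
\<close>

lemma connected_Union:
  assumes "\<H> \<noteq> {}" and H: "\<And>H. H \<in> \<H> \<Longrightarrow> subgraph H G \<and> connected H \<and> x \<in> verts H"
  shows "connected (Union \<H>)"
proof -
  let ?U = "Union \<H>"
  have sub: "subgraph ?U G" "\<And>H. H \<in> \<H> \<Longrightarrow> subgraph H ?U"
    using subgraph_Union[of \<H>] H by blast+
  have "S = verts ?U" if S: "S \<subseteq> verts ?U" "S \<noteq> {}" "\<forall>e \<in> arcs ?U. tail ?U e \<in> S \<longleftrightarrow> head ?U e \<in> S" for S
  proof -
    have sat: "verts H \<subseteq> S" if "H \<in> \<H>" "S \<inter> verts H \<noteq> {}" for H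
    proof -
      have h: "wf_digraph H" "connected H" "subgraph H ?U"
        using H[OF that(1)] sub(2)[OF that(1)] by (auto simp: subgraph_def)
      have "\<forall>e \<in> arcs H. tail H e \<in> S \<inter> verts H \<longleftrightarrow> head H e \<in> S \<inter> verts H"
        using S(3) h(1,3) by (auto simp: subgraph_def compatible_def wf_digraph_def)
      then have "S \<inter> verts H = verts H"
        using connected_no_closed_subset[OF h(1,2), of "S \<inter> verts H"] that(2) by simp
      then show ?thesis by blast
    qed
    obtain u where "u \<in> S" using S(2) by blast
    moreover from this obtain H1 where "H1 \<in> \<H>" "u \<in> verts H1"
      using S(1) by (auto simp: Union_def)
    ultimately have "x \<in> S" using sat[of H1] H by blast
    then have "verts H \<subseteq> S" if "H \<in> \<H>" for H
      using sat[OF that] H[OF that] by blast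
    then show ?thesis using S(1) by (auto simp: Union_def)
  qed
  moreover have "verts ?U \<noteq> {}" using assms by (force simp: Union_def)
  moreover have "wf_digraph ?U" using sub(1) by (simp add: subgraph_def)
  ultimately show ?thesis by (simp add: connected_iff_no_closed_subset)
qed

text \<open>
  By maximality, since the union of \<open>C\<close> and \<open>H\<close> is connected. Uniqueness of components and their
  closedness under arrows are the cases in which \<open>H\<close> is a component or a single arrow with its ends.
\<close>

lemma connected_component_absorbs:
  assumes "connected_component G C" "subgraph H G" "connected H" "x \<in> verts H" "x \<in> verts C"
  shows "subgraph H C"
proof -
  let ?U = "Union {C, H}"
  have C: "subgraph C G" "connected C"
    using assms(1) by (auto simp: connected_component_def max_subgraph_def)
  have "subgraph ?U G" "subgraph C ?U" "subgraph H ?U"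
    using subgraph_Union[of "{C, H}"] C assms(2) by blast+
  moreover have "connected ?U"
    by (rule connected_Union[where x = x]) (use C assms in auto)
  ultimately have "?U = C"
    using assms(1) unfolding connected_component_def max_subgraph_def by blast
  then show ?thesis using \<open>subgraph H ?U\<close> by simp
qed

lemma connected_component_unique:
  assumes "connected_component G C" "connected_component G D" "x \<in> verts C" "x \<in> verts D"
  shows "C = D"
proof (rule subgraph_antisym)
  have "subgraph C G" "connected C" "subgraph D G" "connected D"
    using assms by (auto simp: connected_component_def max_subgraph_def)
  then show "subgraph C D" "subgraph D C"
    using connected_component_absorbs assms by blast+
qed

text \<open>The component of \<open>x\<close> is the union of all connected subgraphs through \<open>x\<close>.\<close>

lemma connected_component_exists:
  assumes "x \<in> verts G"
  obtains C where "connected_component G C" "x \<in> verts C"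
proof -
  let ?\<H> = "{H. subgraph H G \<and> connected H \<and> x \<in> verts H}"
  let ?P = "\<lparr>verts = {x}, arcs = {}, tail = tail G, head = head G\<rparr>"
  have "wf_digraph ?P" by unfold_locales auto
  then have "?P \<in> ?\<H>"
    using assms by (auto simp: subgraph_def compatible_def wf_digraph_axioms connected_iff_no_closed_subset)
  then have ne: "?\<H> \<noteq> {}" by blast
  have sub: "subgraph (Union ?\<H>) G" by (rule subgraph_Union(1)) simp
  have conn: "connected (Union ?\<H>)" by (rule connected_Union[OF ne, of x]) simp
  have x: "x \<in> verts (Union ?\<H>)" using \<open>?P \<in> ?\<H>\<close> by (force simp: Union_def)
  have max: "Union ?\<H> = H" if H: "subgraph (Union ?\<H>) H" "subgraph H G" "connected H" for H
  proof (rule subgraph_antisym[OF H(1)])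
    have "verts (Union ?\<H>) \<subseteq> verts H" using H(1) by (simp add: subgraph_def)
    then have "H \<in> ?\<H>" using x H by blast
    then show "subgraph H (Union ?\<H>)" by (rule subgraph_Union(2)[rotated]) simp
  qed
  have "connected_component G (Union ?\<H>)"
    unfolding connected_component_def
  proof (rule max_subgraphI[where P = connected, OF conn sub], rule notI)
    fix H assume "Union ?\<H> \<noteq> H" "subgraph (Union ?\<H>) H" "subgraph H G" "connected H"
    then show False using max[of H] by simp
  qed
  then show ?thesis using x by (rule that)
qed

lemma connected_component_arc:
  assumes "connected_component G C" "e \<in> arcs G"
  shows "tail G e \<in> verts C \<longleftrightarrow> head G e \<in> verts C"
proof -
  let ?E = "\<lparr>verts = {tail G e, head G e}, arcs = {e}, tail = tail G, head = head G\<rparr>"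
  have wf: "wf_digraph ?E" by unfold_locales auto
  then have "subgraph ?E G"
    using assms(2) by (auto simp: subgraph_def compatible_def wf_digraph_axioms)
  moreover have "connected ?E"
    using wf by (auto simp: connected_iff_no_closed_subset)
  ultimately have "verts ?E \<subseteq> verts C" if "x \<in> verts C" "x \<in> verts ?E" for x
    using connected_component_absorbs[OF assms(1), of ?E x] that by (auto simp: subgraph_def)
  then show ?thesis by auto
qed

end

section \<open>Linear maps in coordinates\<close>

lemma sum_fun_apply: "sum f A x = (\<Sum>a\<in>A. f a x)"
  by (induction A rule: infinite_finite_induct) auto

lemma free_space_expansion:
  assumes "finite S" "x \<in> free_space S"
  shows "x = (\<Sum>v\<in>S. vscale (x v) (gen v))"
proof
  fix u
  have "(\<Sum>v\<in>S. vscale (x v) (gen v)) u = (\<Sum>v\<in>S. if u = v then x v else 0)"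
    unfolding sum_fun_apply by (rule sum.cong) (auto simp: vscale_def gen_def)
  then show "x u = (\<Sum>v\<in>S. vscale (x v) (gen v)) u"
    using assms by (auto simp: free_space_def)
qed

lemma linear_on_free_space_expansion:
  fixes g :: "('v \<Rightarrow> 'k::field) \<Rightarrow> ('w \<Rightarrow> 'k)"
  assumes "finite S"
    and add: "\<And>x y. x \<in> free_space S \<Longrightarrow> y \<in> free_space S \<Longrightarrow> g (x + y) = g x + g y"
    and scale: "\<And>c x. x \<in> free_space S \<Longrightarrow> g (vscale c x) = vscale c (g x)"
    and x: "x \<in> free_space S"
  shows "g x = (\<Sum>v\<in>S. vscale (x v) (g (gen v)))"
proof -
  have g: "vscale (x v) (gen v) \<in> free_space S" "gen v \<in> (free_space S :: ('v \<Rightarrow> 'k) set)"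
    if "v \<in> S" for v
    using that by (auto simp: free_space_def vscale_def gen_def)
  have g0: "g 0 = 0" using add[of 0 0] by (simp add: free_space_def)
  have "g (\<Sum>v\<in>T. vscale (x v) (gen v)) = (\<Sum>v\<in>T. vscale (x v) (g (gen v)))" if "T \<subseteq> S" for T
    using finite_subset[OF that assms(1)] that
  proof induction
    case empty
    then show ?case by (simp only: sum.empty g0)
  next
    case (insert v T)
    then have sT: "(\<Sum>v\<in>T. vscale (x v) (gen v)) \<in> free_space S" and v: "v \<in> S"
      using g(1) by (auto intro: free_space_sum)
    have "g (vscale (x v) (gen v) + (\<Sum>v\<in>T. vscale (x v) (gen v))) =
        vscale (x v) (g (gen v)) + g (\<Sum>v\<in>T. vscale (x v) (gen v))"
      unfolding add[OF g(1)[OF v] sT] scale[OF g(2)[OF v]] ..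
    then show ?case
      using insert.IH insert.prems unfolding sum.insert[OF insert.hyps] by (simp only: insert_subset)
  qed
  from this[of S] show ?thesis using free_space_expansion[OF assms(1) x] by simp
qed

lemma hom_K_expansion:
  assumes "g \<in> hom_K (free_space S) T" "finite S" "x \<in> free_space S"
  shows "g x = (\<Sum>v\<in>S. vscale (x v) (g (gen v)))"
  by (rule linear_on_free_space_expansion[OF assms(2) _ _ assms(3)])
    (use assms(1) in \<open>unfold hom_K_def, blast+\<close>)

lemma space_scalar_ext: "space (scalar_ext Q V) i = free_space (nonzero V i)"
  by (simp add: scalar_ext_def)

lemma hom_prod_zero: "0 \<in> hom_prod Q (scalar_ext Q V) (scalar_ext Q W)"
  by (auto simp: hom_prod_def hom_K_def scalar_ext_def free_space_def)

lemma hom_prod_add: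
  "f \<in> hom_prod Q (scalar_ext Q V) (scalar_ext Q W) \<Longrightarrow>
   g \<in> hom_prod Q (scalar_ext Q V) (scalar_ext Q W) \<Longrightarrow>
   f + g \<in> hom_prod Q (scalar_ext Q V) (scalar_ext Q W)"
  by (auto simp: hom_prod_def hom_K_def space_scalar_ext free_space_def vscale_add)

lemma hom_prod_sum:
  "(\<And>a. a \<in> A \<Longrightarrow> f a \<in> hom_prod Q (scalar_ext Q V) (scalar_ext Q W)) \<Longrightarrow>
   sum f A \<in> hom_prod Q (scalar_ext Q V) (scalar_ext Q W)"
  by (induction A rule: infinite_finite_induct) (auto intro: hom_prod_zero hom_prod_add)

text \<open>
  The two tags agree on the vertices of the tensor coefficient quiver, so the first one names the
  member of the family to look at.
\<close>

definition entry :: "('q \<Rightarrow> ('v \<Rightarrow> 'k::field) \<Rightarrow> ('w \<Rightarrow> 'k)) \<Rightarrow> ('q \<times> 'v) \<times> ('q \<times> 'w) \<Rightarrow> 'k" where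
  "entry f = (\<lambda>((i, v), (_, w)). f i (gen v) w)"

lemma entry_sum: "entry (sum f A) p = (\<Sum>a\<in>A. entry (f a) p)"
  by (simp add: entry_def sum_fun_apply split: prod.split)

lemma entry_fam_scale: "entry (fam_scale c f) p = c * entry f p"
  by (simp add: entry_def fam_scale_def vscale_def split: prod.split)

section \<open>Coefficient quivers in terms of the maps\<close>

lemma verts_tensor_coeff_quiver:
  "verts (tensor_coeff_quiver Q V W) =
     {((i, v), (i, w)) | i v w. i \<in> verts Q \<and> v \<in> nonzero V i \<and> w \<in> nonzero W i}"
  by (auto simp: tensor_coeff_quiver_def coeff_quiver_def)

text \<open>
  Reflecting successors and inducing predecessors are conditions on the single vertices of a
  component; this is their conjunction at one vertex, in terms of the maps instead of the arrows of
  the coefficient quivers. It has to be separated from components because a homomorphism has entry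
  \<open>0\<close> at a bad vertex, and only then, by constancy, on its whole component.
\<close>

definition admissible_at ::
  "('q, 'a) pre_digraph \<Rightarrow> ('q, 'a, 'v) f1_rep \<Rightarrow> ('q, 'a, 'w) f1_rep \<Rightarrow> ('q \<times> 'v) \<times> ('q \<times> 'w) \<Rightarrow> bool"
where
  "admissible_at Q V W = (\<lambda>((i, v), (_, w)).
     (\<forall>\<alpha> \<in> arcs Q. tail Q \<alpha> = i \<and> act W \<alpha> w \<noteq> base W (head Q \<alpha>) \<longrightarrow> act V \<alpha> v \<noteq> base V (head Q \<alpha>)) \<and>
     (\<forall>\<alpha> \<in> arcs Q. head Q \<alpha> = i \<and> v \<in> act V \<alpha> ` nonzero V (tail Q \<alpha>) \<longrightarrow>
        w \<in> act W \<alpha> ` nonzero W (tail Q \<alpha>)))"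

context
  fixes Q :: "('q, 'a) pre_digraph" and V :: "('q, 'a, 'v) f1_rep" and W :: "('q, 'a, 'w) f1_rep"
  assumes finQ: "fin_digraph Q"
    and V: "f1_representation Q V" and W: "f1_representation Q W"
begin

private lemma wfQ: "wf_digraph Q"
  using finQ by (simp add: fin_digraph_def)

private lemmas ends = wf_digraph.tail_in_verts[OF wfQ] wf_digraph.head_in_verts[OF wfQ]

private lemma finite_nonzero:
  "i \<in> verts Q \<Longrightarrow> finite (nonzero V i)" "i \<in> verts Q \<Longrightarrow> finite (nonzero W i)"
  using V W by (auto simp: f1_representation_def f1_vector_space_def)

lemma finite_verts_tensor_coeff_quiver: "finite (verts (tensor_coeff_quiver Q V W))"
proof -
  have "finite (Sigma (verts Q) (nonzero V))" "finite (Sigma (verts Q) (nonzero W))"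
    using finQ finite_nonzero by (auto simp: fin_digraph_def fin_digraph_axioms_def)
  then show ?thesis
    by (rule finite_subset[rotated, OF finite_cartesian_product]) (auto simp: verts_tensor_coeff_quiver)
qed

lemma arcs_tensor_coeff_quiver:
  "arcs (tensor_coeff_quiver Q V W) =
     {((\<alpha>, (tail Q \<alpha>, v), (head Q \<alpha>, act V \<alpha> v)), (\<alpha>, (tail Q \<alpha>, w), (head Q \<alpha>, act W \<alpha> w))) | \<alpha> v w.
        \<alpha> \<in> arcs Q \<and> v \<in> nonzero V (tail Q \<alpha>) \<and> w \<in> nonzero W (tail Q \<alpha>) \<and>
        act V \<alpha> v \<noteq> base V (head Q \<alpha>) \<and> act W \<alpha> w \<noteq> base W (head Q \<alpha>)}"
  using ends act_in[OF wfQ V W]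
  by (auto simp: tensor_coeff_quiver_def coeff_quiver_def)

lemma admissible_component_iff:
  "admissible_component Q V W C \<longleftrightarrow>
     connected_component (tensor_coeff_quiver Q V W) C \<and> (\<forall>p \<in> verts C. admissible_at Q V W p)"
proof -
  have arcsV: "arcs (coeff_quiver Q V) = {(\<alpha>, (tail Q \<alpha>, v), (head Q \<alpha>, act V \<alpha> v)) | \<alpha> v.
      \<alpha> \<in> arcs Q \<and> v \<in> nonzero V (tail Q \<alpha>) \<and> act V \<alpha> v \<noteq> base V (head Q \<alpha>)}"
    and arcsW: "arcs (coeff_quiver Q W) = {(\<alpha>, (tail Q \<alpha>, w), (head Q \<alpha>, act W \<alpha> w)) | \<alpha> w.
      \<alpha> \<in> arcs Q \<and> w \<in> nonzero W (tail Q \<alpha>) \<and> act W \<alpha> w \<noteq> base W (head Q \<alpha>)}"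
    and th: "tail (coeff_quiver Q V) = (\<lambda>(\<alpha>, x, y). x)" "head (coeff_quiver Q V) = (\<lambda>(\<alpha>, x, y). y)"
      "tail (coeff_quiver Q W) = (\<lambda>(\<alpha>, x, y). x)" "head (coeff_quiver Q W) = (\<lambda>(\<alpha>, x, y). y)"
    using ends act_in[OF wfQ V W] by (auto simp: coeff_quiver_def)
  have "reflects_successors Q V W C \<and> induces_predecessors Q V W C \<longleftrightarrow>
      (\<forall>p \<in> verts C. admissible_at Q V W p)"
    if C: "verts C \<subseteq> verts (tensor_coeff_quiver Q V W)"
  proof -
    have "(\<forall>b \<in> arcs (coeff_quiver Q W). tail (coeff_quiver Q W) b = (j, w) \<longrightarrow>
            (\<exists>a \<in> arcs (coeff_quiver Q V). tail (coeff_quiver Q V) a = (i, v) \<and> fst a = fst b)) \<and>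
          (\<forall>a \<in> arcs (coeff_quiver Q V). head (coeff_quiver Q V) a = (i, v) \<longrightarrow>
            (\<exists>b \<in> arcs (coeff_quiver Q W). head (coeff_quiver Q W) b = (j, w) \<and> fst a = fst b)) \<longleftrightarrow>
          admissible_at Q V W ((i, v), (j, w))" if "((i, v), (j, w)) \<in> verts C" for i v j w
    proof -
      have "j = i" "v \<in> nonzero V i" "w \<in> nonzero W i"
        using that C by (auto simp: verts_tensor_coeff_quiver)
      then show ?thesis
        unfolding arcsV arcsW th admissible_at_def prod.case
        by (intro arg_cong2[where f = "(\<and>)"]) auto
    qed
    then show ?thesis
      unfolding reflects_successors_def induces_predecessors_def by fast
  qed
  then show ?thesis
    unfolding admissible_component_def connected_component_def pre_digraph.max_subgraph_def subgraph_def
    by blast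
qed

section \<open>Homomorphisms as functions on the coefficient quiver\<close>

private lemma lmap_gen:
  assumes "\<alpha> \<in> arcs Q" "v \<in> nonzero V (tail Q \<alpha>)"
  shows "lmap (scalar_ext Q V) \<alpha> (gen v) =
    (if act V \<alpha> v = base V (head Q \<alpha>) then 0 else gen (act V \<alpha> v))"
proof -
  have "lmap (scalar_ext Q V) \<alpha> (gen v) = (\<Sum>u \<in> nonzero V (tail Q \<alpha>).
      if u = v then (if act V \<alpha> u = base V (head Q \<alpha>) then 0 else gen (act V \<alpha> u)) else 0)"
    unfolding scalar_ext_def lin_rep.simps
    by (rule sum.cong) (auto simp: vscale_def gen_def fun_eq_iff)
  then show ?thesis using assms ends finite_nonzero by (auto simp: sum.delta)
qed

text \<open>
  Injectivity of \<open>W\<^sub>\<alpha>\<close> off its kernel leaves one summand in the coefficient at \<open>W\<^sub>\<alpha> w\<close>.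
\<close>

private lemma lmap_apply_image:
  assumes "\<alpha> \<in> arcs Q" "w \<in> nonzero W (tail Q \<alpha>)" "act W \<alpha> w \<noteq> base W (head Q \<alpha>)"
  shows "lmap (scalar_ext Q W) \<alpha> y (act W \<alpha> w) = y w"
proof -
  have inj: "u = w" if "u \<in> nonzero W (tail Q \<alpha>)" "act W \<alpha> w = act W \<alpha> u" for u
    using act_inj(2)[OF wfQ V W assms(1), of w u] that assms by auto
  have "lmap (scalar_ext Q W) \<alpha> y (act W \<alpha> w) = (\<Sum>u \<in> nonzero W (tail Q \<alpha>). if u = w then y u else 0)"
    unfolding scalar_ext_def lin_rep.simps sum_fun_apply
    by (rule sum.cong) (use assms(3) inj in \<open>auto simp: vscale_def gen_def\<close>)
  then show ?thesis using assms ends finite_nonzero by (auto simp: sum.delta)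
qed

private lemma lmap_apply_not_image:
  assumes "w \<notin> act W \<alpha> ` nonzero W (tail Q \<alpha>)"
  shows "lmap (scalar_ext Q W) \<alpha> y w = 0"
  unfolding scalar_ext_def lin_rep.simps sum_fun_apply
  by (rule sum.neutral) (use assms in \<open>auto simp: vscale_def gen_def\<close>)

private lemma hom_prod_in_space:
  assumes "f \<in> hom_prod Q (scalar_ext Q V) (scalar_ext Q W)" "i \<in> verts Q"
  shows "f i x \<in> free_space (nonzero W i)"
  using assms by (cases "x \<in> free_space (nonzero V i)")
    (auto simp: hom_prod_def hom_K_def space_scalar_ext, auto simp: free_space_def)

lemma hom_prod_eqI:
  assumes f: "f \<in> hom_prod Q (scalar_ext Q V) (scalar_ext Q W)"
    and g: "g \<in> hom_prod Q (scalar_ext Q V) (scalar_ext Q W)"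
    and eq: "\<And>p. p \<in> verts (tensor_coeff_quiver Q V W) \<Longrightarrow> entry f p = entry g p"
  shows "f = g"
proof (intro ext)
  fix i x w
  show "f i x w = g i x w"
  proof (cases "i \<in> verts Q \<and> x \<in> free_space (nonzero V i)")
    case True
    have "f i (gen v) = g i (gen v)" if v: "v \<in> nonzero V i" for v
    proof
      fix u
      show "f i (gen v) u = g i (gen v) u"
      proof (cases "u \<in> nonzero W i")
        case True
        then show ?thesis
          using eq[of "((i, v), (i, u))"] v \<open>i \<in> verts Q \<and> _\<close>
          by (simp add: entry_def verts_tensor_coeff_quiver)
      next
        case False
        then show ?thesis
          using hom_prod_in_space[OF f, of i] hom_prod_in_space[OF g, of i] \<open>i \<in> verts Q \<and> _\<close>
          unfolding free_space_def by auto
      qed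
    qed
    then have "(\<Sum>v\<in>nonzero V i. vscale (x v) (f i (gen v))) = (\<Sum>v\<in>nonzero V i. vscale (x v) (g i (gen v)))"
      by (intro sum.cong) simp_all
    moreover have fgK: "f i \<in> hom_K (free_space (nonzero V i)) (free_space (nonzero W i))"
      "g i \<in> hom_K (free_space (nonzero V i)) (free_space (nonzero W i))"
      using f g True by (auto simp: hom_prod_def space_scalar_ext)
    moreover note fgK[THEN hom_K_expansion, OF finite_nonzero(1), of x]
    ultimately have "f i x = g i x" using True by simp
    then show ?thesis by simp
  next
    case False
    then have "f i x = 0" "g i x = 0"
      using f g by (auto simp: hom_prod_def hom_K_def space_scalar_ext)
    then show ?thesis by simp
  qed
qed

lemma rep_hom_iff_on_gen:
  assumes f: "f \<in> hom_prod Q (scalar_ext Q V) (scalar_ext Q W)"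
  shows "f \<in> rep_hom Q (scalar_ext Q V) (scalar_ext Q W) \<longleftrightarrow>
    (\<forall>\<alpha> \<in> arcs Q. \<forall>v \<in> nonzero V (tail Q \<alpha>). \<forall>w \<in> nonzero W (head Q \<alpha>).
       f (head Q \<alpha>) (lmap (scalar_ext Q V) \<alpha> (gen v)) w =
       lmap (scalar_ext Q W) \<alpha> (f (tail Q \<alpha>) (gen v)) w)"
    (is "_ \<longleftrightarrow> ?R")
proof
  assume fU: "f \<in> rep_hom Q (scalar_ext Q V) (scalar_ext Q W)"
  show ?R
  proof (intro ballI)
    fix \<alpha> v w assume "\<alpha> \<in> arcs Q" "v \<in> nonzero V (tail Q \<alpha>)"
    moreover from this have "gen v \<in> free_space (nonzero V (tail Q \<alpha>))"
      by (auto simp: free_space_def gen_def)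
    ultimately have "f (head Q \<alpha>) (lmap (scalar_ext Q V) \<alpha> (gen v)) =
        lmap (scalar_ext Q W) \<alpha> (f (tail Q \<alpha>) (gen v))"
      using fU unfolding rep_hom_def space_scalar_ext by blast
    then show "f (head Q \<alpha>) (lmap (scalar_ext Q V) \<alpha> (gen v)) w =
        lmap (scalar_ext Q W) \<alpha> (f (tail Q \<alpha>) (gen v)) w" by simp
  qed
next
  assume R: ?R
  have "f (head Q \<alpha>) (lmap (scalar_ext Q V) \<alpha> x) = lmap (scalar_ext Q W) \<alpha> (f (tail Q \<alpha>) x)"
    if \<alpha>: "\<alpha> \<in> arcs Q" and x: "x \<in> free_space (nonzero V (tail Q \<alpha>))" for \<alpha> x
  proof -
    let ?S = "nonzero V (tail Q \<alpha>)"
    let ?g = "\<lambda>x. f (head Q \<alpha>) (lmap (scalar_ext Q V) \<alpha> x)"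
    let ?h = "\<lambda>x. lmap (scalar_ext Q W) \<alpha> (f (tail Q \<alpha>) x)"
    have fin: "finite ?S" using finite_nonzero ends[OF \<alpha>] by simp
    have fK: "f i \<in> hom_K (free_space (nonzero V i)) (free_space (nonzero W i))" if "i \<in> verts Q" for i
      using f that by (auto simp: hom_prod_def space_scalar_ext)
    have gh: "?g (gen v) = ?h (gen v)" if v: "v \<in> ?S" for v
    proof
      fix w
      show "?g (gen v) w = ?h (gen v) w"
      proof (cases "w \<in> nonzero W (head Q \<alpha>)")
        case True
        then show ?thesis using R \<alpha> v by blast
      next
        case False
        then show ?thesis
          using hom_prod_in_space[OF f ends(2)[OF \<alpha>]] lmap_scalar_ext_in[OF W \<alpha>]
          unfolding space_scalar_ext free_space_def mem_Collect_eq by metis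
      qed
    qed
    have "?g x = (\<Sum>v\<in>?S. vscale (x v) (?g (gen v)))"
      by (rule linear_on_free_space_expansion[OF fin _ _ x])
        (use fK[OF ends(2)[OF \<alpha>]] lmap_scalar_ext_in[OF V \<alpha>] in
          \<open>unfold hom_K_def lmap_scalar_ext_add lmap_scalar_ext_scale space_scalar_ext, blast+\<close>)
    also have "\<dots> = (\<Sum>v\<in>?S. vscale (x v) (?h (gen v)))"
      by (rule sum.cong[OF refl]) (simp only: gh)
    also have "\<dots> = ?h x"
      by (rule linear_on_free_space_expansion[OF fin _ _ x, symmetric])
        (use fK[OF ends(1)[OF \<alpha>]] in
          \<open>unfold hom_K_def, auto simp only: mem_Collect_eq lmap_scalar_ext_add lmap_scalar_ext_scale\<close>)
    finally show ?thesis .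
  qed
  then show "f \<in> rep_hom Q (scalar_ext Q V) (scalar_ext Q W)"
    using f by (auto simp: rep_hom_def space_scalar_ext)
qed

text \<open>
  The commutation relation for \<open>\<alpha>\<close>, \<open>v\<close> and the coordinate \<open>w'\<close> takes one of four forms, according
  to whether \<open>V\<^sub>\<alpha> v = 0\<close> and whether \<open>w'\<close> lies in the image of \<open>W\<^sub>\<alpha>\<close>: equality along an arrow of
  the tensor coefficient quiver (\<open>comm_arc\<close>), vanishing where a successor is not reflected
  (\<open>comm_succ\<close>) or a predecessor is not induced (\<open>comm_pred\<close>), and \<open>0 = 0\<close> (\<open>comm_none\<close>).
\<close>

lemma rep_hom_iff_entries:
  fixes f :: "'q \<Rightarrow> ('v \<Rightarrow> 'k::field) \<Rightarrow> ('w \<Rightarrow> 'k)"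
  assumes f: "f \<in> hom_prod Q (scalar_ext Q V) (scalar_ext Q W)"
  defines "G \<equiv> tensor_coeff_quiver Q V W"
  shows "f \<in> rep_hom Q (scalar_ext Q V) (scalar_ext Q W) \<longleftrightarrow>
    (\<forall>e \<in> arcs G. entry f (tail G e) = entry f (head G e)) \<and>
    (\<forall>p \<in> verts G. \<not> admissible_at Q V W p \<longrightarrow> entry f p = 0)"
proof -
  define comm where "comm \<alpha> v w \<longleftrightarrow>
    f (head Q \<alpha>) (lmap (scalar_ext Q V) \<alpha> (gen v)) w =
    lmap (scalar_ext Q W) \<alpha> (f (tail Q \<alpha>) (gen v)) w" for \<alpha> v w
  have f0: "f i 0 = 0" if "i \<in> verts Q" for i
  proof -
    have "\<forall>x \<in> free_space (nonzero V i). \<forall>y \<in> free_space (nonzero V i). f i (x + y) = f i x + f i y"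
      using f that by (simp add: hom_prod_def hom_K_def space_scalar_ext)
    from this[rule_format, of 0 0] show ?thesis by (simp add: free_space_def)
  qed
  have comm_arc: "comm \<alpha> v (act W \<alpha> w) \<longleftrightarrow> f (head Q \<alpha>) (gen (act V \<alpha> v)) (act W \<alpha> w) = f (tail Q \<alpha>) (gen v) w"
    if "\<alpha> \<in> arcs Q" "v \<in> nonzero V (tail Q \<alpha>)" "w \<in> nonzero W (tail Q \<alpha>)"
      "act V \<alpha> v \<noteq> base V (head Q \<alpha>)" "act W \<alpha> w \<noteq> base W (head Q \<alpha>)" for \<alpha> v w
    using that by (simp add: comm_def lmap_gen lmap_apply_image)
  have comm_succ: "comm \<alpha> v (act W \<alpha> w) \<longleftrightarrow> f (tail Q \<alpha>) (gen v) w = 0"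
    if "\<alpha> \<in> arcs Q" "v \<in> nonzero V (tail Q \<alpha>)" "w \<in> nonzero W (tail Q \<alpha>)"
      "act V \<alpha> v = base V (head Q \<alpha>)" "act W \<alpha> w \<noteq> base W (head Q \<alpha>)" for \<alpha> v w
    using that f0 ends by (auto simp add: comm_def lmap_gen lmap_apply_image)
  have comm_pred: "comm \<alpha> v w \<longleftrightarrow> f (head Q \<alpha>) (gen (act V \<alpha> v)) w = 0"
    if "\<alpha> \<in> arcs Q" "v \<in> nonzero V (tail Q \<alpha>)" "w \<notin> act W \<alpha> ` nonzero W (tail Q \<alpha>)"
      "act V \<alpha> v \<noteq> base V (head Q \<alpha>)" for \<alpha> v w
    using that by (simp add: comm_def lmap_gen lmap_apply_not_image)
  have comm_none: "comm \<alpha> v w"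
    if "\<alpha> \<in> arcs Q" "v \<in> nonzero V (tail Q \<alpha>)" "w \<notin> act W \<alpha> ` nonzero W (tail Q \<alpha>)"
      "act V \<alpha> v = base V (head Q \<alpha>)" for \<alpha> v w
    using that f0 ends by (simp add: comm_def lmap_gen lmap_apply_not_image)
  have th: "tail G = (\<lambda>((\<alpha>, x, y), (\<beta>, x', y')). (x, x'))"
    "head G = (\<lambda>((\<alpha>, x, y), (\<beta>, x', y')). (y, y'))"
    by (auto simp: G_def tensor_coeff_quiver_def coeff_quiver_def)
  have rep: "f \<in> rep_hom Q (scalar_ext Q V) (scalar_ext Q W) \<longleftrightarrow>
    (\<forall>\<alpha> \<in> arcs Q. \<forall>v \<in> nonzero V (tail Q \<alpha>). \<forall>w \<in> nonzero W (head Q \<alpha>). comm \<alpha> v w)"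
    unfolding comm_def by (rule rep_hom_iff_on_gen[OF f])
  note act_in = act_in[OF wfQ V W]
  show ?thesis
    unfolding rep
  proof (intro iffI conjI ballI impI)
    assume comm: "\<forall>\<alpha> \<in> arcs Q. \<forall>v \<in> nonzero V (tail Q \<alpha>). \<forall>w \<in> nonzero W (head Q \<alpha>). comm \<alpha> v w"
    fix e assume "e \<in> arcs G"
    then obtain \<alpha> v w where
      e: "e = ((\<alpha>, (tail Q \<alpha>, v), (head Q \<alpha>, act V \<alpha> v)), (\<alpha>, (tail Q \<alpha>, w), (head Q \<alpha>, act W \<alpha> w)))"
      and a: "\<alpha> \<in> arcs Q" "v \<in> nonzero V (tail Q \<alpha>)" "w \<in> nonzero W (tail Q \<alpha>)"
        "act V \<alpha> v \<noteq> base V (head Q \<alpha>)" "act W \<alpha> w \<noteq> base W (head Q \<alpha>)"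
      unfolding G_def arcs_tensor_coeff_quiver by blast
    have "comm \<alpha> v (act W \<alpha> w)" using comm a act_in(2)[of \<alpha> w] by auto
    then show "entry f (tail G e) = entry f (head G e)"
      unfolding comm_arc[OF a] by (simp add: e th entry_def)
  next
    assume comm: "\<forall>\<alpha> \<in> arcs Q. \<forall>v \<in> nonzero V (tail Q \<alpha>). \<forall>w \<in> nonzero W (head Q \<alpha>). comm \<alpha> v w"
    fix p assume "p \<in> verts G" and na: "\<not> admissible_at Q V W p"
    then obtain i v w where p: "p = ((i, v), (i, w))" "v \<in> nonzero V i" "w \<in> nonzero W i"
      by (auto simp: G_def verts_tensor_coeff_quiver)
    consider \<alpha> where "\<alpha> \<in> arcs Q" "tail Q \<alpha> = i" "act W \<alpha> w \<noteq> base W (head Q \<alpha>)" "act V \<alpha> v = base V (head Q \<alpha>)"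
      | \<alpha> u where "\<alpha> \<in> arcs Q" "head Q \<alpha> = i" "u \<in> nonzero V (tail Q \<alpha>)" "v = act V \<alpha> u"
          "w \<notin> act W \<alpha> ` nonzero W (tail Q \<alpha>)"
      using na unfolding admissible_at_def p(1) prod.case by blast
    then show "entry f p = 0"
    proof cases
      case 1
      then have "comm \<alpha> v (act W \<alpha> w)" using comm p act_in(2)[of \<alpha> w] by auto
      then show ?thesis using comm_succ[of \<alpha> v w] 1 p by (simp add: entry_def)
    next
      case 2
      then have "comm \<alpha> u w" using comm p by auto
      then show ?thesis using comm_pred[of \<alpha> u w] 2 p by (simp add: entry_def)
    qed
  next
    fix \<alpha> v w
    assume ent: "(\<forall>e \<in> arcs G. entry f (tail G e) = entry f (head G e)) \<and>
        (\<forall>p \<in> verts G. \<not> admissible_at Q V W p \<longrightarrow> entry f p = 0)"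
      and a: "\<alpha> \<in> arcs Q" "v \<in> nonzero V (tail Q \<alpha>)" and w: "w \<in> nonzero W (head Q \<alpha>)"
    show "comm \<alpha> v w"
    proof (cases "w \<in> act W \<alpha> ` nonzero W (tail Q \<alpha>)")
      case True
      then obtain u where u: "w = act W \<alpha> u" "u \<in> nonzero W (tail Q \<alpha>)" by blast
      have u0: "act W \<alpha> u \<noteq> base W (head Q \<alpha>)" using u w by simp
      show ?thesis
      proof (cases "act V \<alpha> v = base V (head Q \<alpha>)")
        case True
        have "((tail Q \<alpha>, v), (tail Q \<alpha>, u)) \<in> verts G"
          using a u ends by (simp add: G_def verts_tensor_coeff_quiver)
        moreover have "\<not> admissible_at Q V W ((tail Q \<alpha>, v), (tail Q \<alpha>, u))"
          using True a u0 unfolding admissible_at_def by auto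
        ultimately have "entry f ((tail Q \<alpha>, v), (tail Q \<alpha>, u)) = 0" using ent by blast
        then show ?thesis using comm_succ[OF a u(2) True u0] u(1) by (simp add: entry_def)
      next
        case False
        let ?e = "((\<alpha>, (tail Q \<alpha>, v), (head Q \<alpha>, act V \<alpha> v)), (\<alpha>, (tail Q \<alpha>, u), (head Q \<alpha>, act W \<alpha> u)))"
        have "?e \<in> arcs G"
          unfolding G_def arcs_tensor_coeff_quiver using a u(2) u0 False by blast
        then have "entry f (tail G ?e) = entry f (head G ?e)" using ent by blast
        then show ?thesis using comm_arc[OF a u(2) False u0] u(1) by (simp add: entry_def th)
      qed
    next
      case w': False
      show ?thesis
      proof (cases "act V \<alpha> v = base V (head Q \<alpha>)")
        case True
        then show ?thesis using comm_none a w' by blast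
      next
        case False
        have "((head Q \<alpha>, act V \<alpha> v), (head Q \<alpha>, w)) \<in> verts G"
          using a w False ends act_in(1)[of \<alpha> v] by (simp add: G_def verts_tensor_coeff_quiver)
        moreover have "\<not> admissible_at Q V W ((head Q \<alpha>, act V \<alpha> v), (head Q \<alpha>, w))"
          using a w' unfolding admissible_at_def by auto
        ultimately have "entry f ((head Q \<alpha>, act V \<alpha> v), (head Q \<alpha>, w)) = 0" using ent by blast
        then show ?thesis using comm_pred[OF a w' False] by (simp add: entry_def)
      qed
    qed
  qed
qed

lemma b_comp_in_hom_prod:
  assumes "verts C \<subseteq> verts (tensor_coeff_quiver Q V W)"
  shows "b_comp V C \<in> hom_prod Q (scalar_ext Q V) (scalar_ext Q W)"
  unfolding b_comp_def
  by (rule hom_prod_sum) (use assms b_elem_in_hom_prod in \<open>fastforce simp: verts_tensor_coeff_quiver\<close>)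

lemma entry_b_comp:
  assumes C: "verts C \<subseteq> verts (tensor_coeff_quiver Q V W)"
    and p: "p \<in> verts (tensor_coeff_quiver Q V W)"
  shows "entry (b_comp V C) p = (if p \<in> verts C then 1 else 0)"
proof -
  have "entry (case q of (v, w) \<Rightarrow> b_elem V v w) p = (if q = p then 1 else 0)" if "q \<in> verts C" for q
  proof -
    have "q \<in> verts (tensor_coeff_quiver Q V W)" using that C by blast
    then obtain j v' w' where "q = ((j, v'), (j, w'))"
      unfolding verts_tensor_coeff_quiver by blast
    moreover obtain i v w where "p = ((i, v), (i, w))" "v \<in> nonzero V i" "w \<in> nonzero W i"
      using p unfolding verts_tensor_coeff_quiver by blast
    ultimately show ?thesis
      by (auto simp: entry_def b_elem_def gen_def vscale_def free_space_def)
  qed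
  then have "entry (b_comp V C) p = (\<Sum>q \<in> verts C. if q = p then 1 else 0)"
    unfolding b_comp_def entry_sum by (rule sum.cong[OF refl])
  also have "\<dots> = (if p \<in> verts C then 1 else 0)"
    using finite_subset[OF C finite_verts_tensor_coeff_quiver] by (simp add: sum.delta)
  finally show ?thesis .
qed

section \<open>The basis\<close>

private abbreviation "adm \<equiv> {C. admissible_component Q V W C}"

private lemma adm_props:
  assumes "C \<in> adm"
  shows "connected_component (tensor_coeff_quiver Q V W) C"
    and "verts C \<subseteq> verts (tensor_coeff_quiver Q V W)" and "verts C \<noteq> {}"
    and "p \<in> verts C \<Longrightarrow> admissible_at Q V W p"
  using assms unfolding admissible_component_iff connected_component_def pre_digraph.max_subgraph_def
    subgraph_def by (auto simp: connected_conv)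

private lemma adm_unique:
  assumes "C \<in> adm" "connected_component (tensor_coeff_quiver Q V W) D" "p \<in> verts C" "p \<in> verts D"
  shows "C = D"
  using wf_digraph.connected_component_unique[OF wf_digraph_tensor_coeff_quiver] adm_props(1) assms
  by blast

private lemma finite_adm: "finite adm"
proof -
  have "inj_on verts adm"
  proof (rule inj_onI)
    fix C D assume CD: "C \<in> adm" "D \<in> adm" "verts C = verts D"
    obtain p where "p \<in> verts C" using adm_props(3)[OF CD(1)] by blast
    then show "C = D" using adm_unique[OF CD(1) adm_props(1)[OF CD(2)]] CD(3) by simp
  qed
  moreover have "verts ` adm \<subseteq> Pow (verts (tensor_coeff_quiver Q V W))" using adm_props(2) by blast
  ultimately show ?thesis
    using finite_verts_tensor_coeff_quiver by (meson finite_Pow_iff finite_imageD finite_subset)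
qed

private lemma basis_set_eq: "basis_set Q V W = b_comp V ` adm"
  by (auto simp: basis_set_def)

text \<open>
  Needed because \<^const>\<open>basis_set\<close> is a set of maps: sums over it have to be reindexed by components.
\<close>

private lemma inj_on_b_comp:
  "inj_on (b_comp V :: _ \<Rightarrow> 'q \<Rightarrow> ('v \<Rightarrow> 'k::field) \<Rightarrow> ('w \<Rightarrow> 'k)) adm"
proof (rule inj_onI)
  fix C D assume CD: "C \<in> adm" "D \<in> adm" and eq: "b_comp V C = (b_comp V D :: 'q \<Rightarrow> ('v \<Rightarrow> 'k) \<Rightarrow> ('w \<Rightarrow> 'k))"
  obtain p where p: "p \<in> verts C" using adm_props(3)[OF CD(1)] by blast
  then have pG: "p \<in> verts (tensor_coeff_quiver Q V W)" using adm_props(2)[OF CD(1)] by blast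
  have "entry (b_comp V C :: 'q \<Rightarrow> ('v \<Rightarrow> 'k) \<Rightarrow> ('w \<Rightarrow> 'k)) p = entry (b_comp V D :: 'q \<Rightarrow> ('v \<Rightarrow> 'k) \<Rightarrow> ('w \<Rightarrow> 'k)) p" using eq by simp
  then have "p \<in> verts D"
    unfolding entry_b_comp[OF adm_props(2)[OF CD(1)] pG] entry_b_comp[OF adm_props(2)[OF CD(2)] pG]
    using p by (simp split: if_splits)
  then show "C = D" by (rule adm_unique[OF CD(1) adm_props(1)[OF CD(2)] p])
qed

text \<open>
  Components are disjoint, so at most the summand of the component through \<open>p\<close> contributes. Both
  linear independence and the spanning property are read off from this.
\<close>

lemma entry_combination_of_b_comp:
  fixes u :: "_ \<Rightarrow> 'k::field"
  assumes D: "connected_component (tensor_coeff_quiver Q V W) D" and p: "p \<in> verts D"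
  shows "entry (\<Sum>C \<in> adm. fam_scale (u C) (b_comp V C)) p = (if D \<in> adm then u D else 0)"
proof -
  have pG: "p \<in> verts (tensor_coeff_quiver Q V W)"
    using D p by (auto simp: connected_component_def pre_digraph.max_subgraph_def subgraph_def)
  have "entry (\<Sum>C \<in> adm. fam_scale (u C) (b_comp V C)) p = (\<Sum>C \<in> adm. if C = D then u C else 0)"
    unfolding entry_sum entry_fam_scale
  proof (rule sum.cong[OF refl])
    fix C assume C: "C \<in> adm"
    have "p \<in> verts C \<longleftrightarrow> C = D" using adm_unique[OF C D] p by blast
    then show "u C * entry (b_comp V C) p = (if C = D then u C else 0)"
      unfolding entry_b_comp[OF adm_props(2)[OF C] pG] by simp
  qed
  then show ?thesis using finite_adm by (simp add: sum.delta)
qed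

lemma basis_set_subset_rep_hom: "basis_set Q V W \<subseteq> rep_hom Q (scalar_ext Q V) (scalar_ext Q W)"
proof
  fix b :: "'q \<Rightarrow> ('v \<Rightarrow> 'k::field) \<Rightarrow> ('w \<Rightarrow> 'k)" assume "b \<in> basis_set Q V W"
  then obtain C where C: "C \<in> adm" and b: "b = b_comp V C" unfolding basis_set_eq by blast
  let ?G = "tensor_coeff_quiver Q V W"
  interpret G: wf_digraph ?G by (rule wf_digraph_tensor_coeff_quiver)
  note entry = entry_b_comp[OF adm_props(2)[OF C]]
  have "tail ?G e \<in> verts C \<longleftrightarrow> head ?G e \<in> verts C" if "e \<in> arcs ?G" for e
    by (rule G.connected_component_arc[OF adm_props(1)[OF C] that])
  then show "b \<in> rep_hom Q (scalar_ext Q V) (scalar_ext Q W)"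
    unfolding b rep_hom_iff_entries[OF b_comp_in_hom_prod[OF adm_props(2)[OF C]]]
    using adm_props(4)[OF C] by (auto simp: entry)
qed

lemma independent_basis_set:
  "\<not> module.dependent fam_scale (basis_set Q V W :: ('q \<Rightarrow> ('v \<Rightarrow> 'k::field) \<Rightarrow> ('w \<Rightarrow> 'k)) set)"
proof -
  interpret vector_space "fam_scale :: 'k \<Rightarrow> ('q \<Rightarrow> ('v \<Rightarrow> 'k) \<Rightarrow> ('w \<Rightarrow> 'k)) \<Rightarrow> _"
    by (rule vector_space_fam_scale)
  let ?B = "basis_set Q V W :: ('q \<Rightarrow> ('v \<Rightarrow> 'k) \<Rightarrow> ('w \<Rightarrow> 'k)) set"
  have fin: "finite ?B" unfolding basis_set_eq by (rule finite_imageI[OF finite_adm])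
  show ?thesis
  proof
    assume "dependent ?B"
    then obtain u b where b: "b \<in> ?B" and "u b \<noteq> 0" and z: "(\<Sum>b \<in> ?B. fam_scale (u b) b) = 0"
      unfolding dependent_finite[OF fin] by blast
    obtain C where C: "C \<in> adm" "b = b_comp V C" using b unfolding basis_set_eq by blast
    obtain p where p: "p \<in> verts C" using adm_props(3)[OF C(1)] by blast
    let ?s = "\<Sum>C \<in> adm. fam_scale (u (b_comp V C)) (b_comp V C :: 'q \<Rightarrow> ('v \<Rightarrow> 'k) \<Rightarrow> ('w \<Rightarrow> 'k))"
    have s0: "?s = 0"
      using z[unfolded basis_set_eq] sum.reindex[OF inj_on_b_comp, of "\<lambda>b. fam_scale (u b) b"]
      by (simp only: o_def)
    have "u b = (if C \<in> adm then u (b_comp V C) else 0)" by (simp only: C(2) if_P[OF C(1)])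
    also have "\<dots> = entry ?s p"
      by (rule entry_combination_of_b_comp[OF adm_props(1)[OF C(1)] p, symmetric])
    also have "\<dots> = 0" unfolding s0 by (simp add: entry_def case_prod_beta)
    finally show False using \<open>u b \<noteq> 0\<close> by contradiction
  qed
qed

text \<open>
  The entries of \<open>f\<close> are constant on each component, so any vertex can be chosen to read off the
  coefficient; on an inadmissible component some entry is zero, hence all are.
\<close>

lemma rep_hom_eq_combination:
  fixes f :: "'q \<Rightarrow> ('v \<Rightarrow> 'k::field) \<Rightarrow> ('w \<Rightarrow> 'k)"
  assumes fU: "f \<in> rep_hom Q (scalar_ext Q V) (scalar_ext Q W)"
  shows "f = (\<Sum>C \<in> adm. fam_scale (entry f (SOME p. p \<in> verts C)) (b_comp V C))" (is "f = ?g")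
proof (rule hom_prod_eqI)
  let ?G = "tensor_coeff_quiver Q V W"
  interpret G: wf_digraph ?G by (rule wf_digraph_tensor_coeff_quiver)
  interpret vector_space "fam_scale :: 'k \<Rightarrow> ('q \<Rightarrow> ('v \<Rightarrow> 'k) \<Rightarrow> ('w \<Rightarrow> 'k)) \<Rightarrow> _"
    by (rule vector_space_fam_scale)
  show f: "f \<in> hom_prod Q (scalar_ext Q V) (scalar_ext Q W)" using fU by (simp add: rep_hom_def)
  have ent_arc: "entry f (tail ?G e) = entry f (head ?G e)" if "e \<in> arcs ?G" for e
    using fU[unfolded rep_hom_iff_entries[OF f]] that by blast
  have ent_adm: "entry f p = 0" if "p \<in> verts ?G" "\<not> admissible_at Q V W p" for p
    using fU[unfolded rep_hom_iff_entries[OF f]] that by blast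
  have "b_comp V C \<in> rep_hom Q (scalar_ext Q V) (scalar_ext Q W)" if "C \<in> adm" for C
    using basis_set_subset_rep_hom that unfolding basis_set_eq by blast
  then have "?g \<in> rep_hom Q (scalar_ext Q V) (scalar_ext Q W)"
    by (intro subspace_sum[OF subspace_rep_hom] subspace_scale[OF subspace_rep_hom])
  then show "?g \<in> hom_prod Q (scalar_ext Q V) (scalar_ext Q W)" by (simp add: rep_hom_def)
  fix p assume p: "p \<in> verts ?G"
  obtain D where D: "connected_component ?G D" and pD: "p \<in> verts D"
    using G.connected_component_exists[OF p] .
  have sub: "wf_digraph D" "arcs D \<subseteq> arcs ?G" "verts D \<subseteq> verts ?G" "tail D = tail ?G" "head D = head ?G"
    and conn: "connected D"
    using D by (auto simp: connected_component_def pre_digraph.max_subgraph_def subgraph_def compatible_def)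
  have const: "entry f p = entry f q" if "q \<in> verts D" for q
  proof (rule constant_on_connected[OF sub(1) conn _ pD that])
    fix e assume "e \<in> arcs D"
    then have "e \<in> arcs ?G" using sub(2) by blast
    then show "entry f (tail D e) = entry f (head D e)" unfolding sub(4,5) by (rule ent_arc)
  qed
  show "entry f p = entry ?g p"
  proof (cases "D \<in> adm")
    case True
    have "(SOME p. p \<in> verts D) \<in> verts D" using pD by (rule someI)
    from const[OF this] show ?thesis unfolding entry_combination_of_b_comp[OF D pD] using True by simp
  next
    case False
    then obtain q where q: "q \<in> verts D" "\<not> admissible_at Q V W q"
      using D by (auto simp: admissible_component_iff)
    have "entry f p = entry f q" by (rule const[OF q(1)])
    also have "\<dots> = 0" by (rule ent_adm[OF subsetD[OF sub(3) q(1)] q(2)])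
    finally have "entry f p = 0" .
    then show ?thesis unfolding entry_combination_of_b_comp[OF D pD] using False by simp
  qed
qed

lemma span_basis_set:
  "module.span fam_scale (basis_set Q V W :: ('q \<Rightarrow> ('v \<Rightarrow> 'k::field) \<Rightarrow> ('w \<Rightarrow> 'k)) set) =
     rep_hom Q (scalar_ext Q V) (scalar_ext Q W)"
proof -
  interpret vector_space "fam_scale :: 'k \<Rightarrow> ('q \<Rightarrow> ('v \<Rightarrow> 'k) \<Rightarrow> ('w \<Rightarrow> 'k)) \<Rightarrow> _"
    by (rule vector_space_fam_scale)
  let ?B = "basis_set Q V W :: ('q \<Rightarrow> ('v \<Rightarrow> 'k) \<Rightarrow> ('w \<Rightarrow> 'k)) set"
  have "f \<in> span ?B" if "f \<in> rep_hom Q (scalar_ext Q V) (scalar_ext Q W)" for f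
  proof -
    have "(\<Sum>C \<in> adm. fam_scale (entry f (SOME p. p \<in> verts C)) (b_comp V C)) \<in> span ?B"
      by (intro span_sum span_scale span_base) (auto simp: basis_set_def)
    then show ?thesis
      by (rule back_subst[of "\<lambda>g. g \<in> span ?B", OF _ rep_hom_eq_combination[OF that, symmetric]])
  qed
  then show ?thesis
    using span_minimal[OF basis_set_subset_rep_hom subspace_rep_hom] by blast
qed

end

theorem theorem4p11:
  fixes Q :: "('q, 'a) pre_digraph"
    and V :: "('q, 'a, 'v) f1_rep"
    and W :: "('q, 'a, 'w) f1_rep"
  assumes "fin_digraph Q"
    and "f1_representation Q V"
    and "f1_representation Q W"
  shows "is_basis_of fam_scale
           (basis_set Q V W :: ('q \<Rightarrow> ('v \<Rightarrow> 'k::field) \<Rightarrow> ('w \<Rightarrow> 'k)) set)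
           (rep_hom Q (scalar_ext Q V) (scalar_ext Q W))"
  using basis_set_subset_rep_hom[OF assms] independent_basis_set[OF assms] span_basis_set[OF assms]
  unfolding is_basis_of_def by blast

end
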